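(* Let $k\ge 2$ be an integer and let $p\ge 2$ be real. Define $$\alpha(k,p)=\begin{cases}\frac{2k-1}{6(k-1)}-\frac{k+1}{3p(k-1)}, & 2\le p\le 4,\\[2pt] \frac12-\frac1p, & p\ge 4.\end{cases}$$ Then for every $\epsilon>0$ there is a constant $C$ depending only on $k,p,\epsilon$ such that for every integer $N\ge 1$ and all $a_n\in\mathbb{C}$, $-N\le n\le N$, $$\Big\|\sum_{n=-N}^N a_n e(nx-n^2x^k)\Big\|_{L^p(-1,1)}\le C\, N^{\alpha(k,p)+\epsilon}\Big(\sum_{n=-N}^N|a_n|^2\Big)^{1/2}.$$ Moreover, apart from the factor $N^\epsilon$, this upper bound is sharp: there is a constant $c>0$ depending only on $k,p$ such that for every integer $N\ge 1$ there are $a_n\in\mathbb{C}$, $-N\le n\le N$, not all zero, with $$\Big\|\sum_{n=-N}^N a_n e(nx-n^2x^k)\Big\|_{L^p(-1,1)}\ge c\, N^{\alpha(k,p)}\Big(\sum_{n=-N}^N|a_n|^2\Big)^{1/2}.$$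
   Context: $e(z)=e^{2\pi i z}$. The $L^p(-1,1)$ norm is taken in the real variable $x$. *)

theory Defs
  imports "HOL-Analysis.Analysis"
begin

definition e :: "complex \<Rightarrow> complex" where
  "e z = exp (2 * complex_of_real pi * \<i> * z)"

text \<open>The integral is the Bochner integral, which is \<open>0\<close> for non-integrable integrands; the
  definition is therefore meaningful when \<open>\<bar>f\<bar>\<^sup>p\<close> is integrable on \<open>S\<close>. It is only applied to
  trigonometric sums, which are continuous and bounded on \<open>S = (-1, 1)\<close>.\<close>

definition Lp_norm :: "real \<Rightarrow> real set \<Rightarrow> (real \<Rightarrow> complex) \<Rightarrow> real" where
  "Lp_norm p S f = (LINT x:S|lborel. norm (f x) powr p) powr (1 / p)"

definition exp_sum :: "nat \<Rightarrow> nat \<Rightarrow> (int \<Rightarrow> complex) \<Rightarrow> real \<Rightarrow> complex" where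
  "exp_sum k N a x =
     (\<Sum>n\<in>{- int N..int N}. a n * e (of_real (of_int n * x - (of_int n)\<^sup>2 * x ^ k)))"

definition l2_norm :: "nat \<Rightarrow> (int \<Rightarrow> complex) \<Rightarrow> real" where
  "l2_norm N a = sqrt (\<Sum>n\<in>{- int N..int N}. (norm (a n))\<^sup>2)"

text \<open>Intended for \<open>k \<ge> 2\<close> and \<open>p \<ge> 2\<close>; the two formulas agree at \<open>p = 4\<close>.\<close>

definition \<alpha> :: "nat \<Rightarrow> real \<Rightarrow> real" where
  "\<alpha> k p =
     (if p \<le> 4 then (2 * real k - 1) / (6 * (real k - 1)) - (real k + 1) / (3 * p * (real k - 1))
      else 1 / 2 - 1 / p)"

end

theory Submission
  imports Defs
begin

text \<open>
  Write \<open>F(x) = \<Sum> a\<^sub>n e(nx - n\<^sup>2x\<^sup>k)\<close>. The bound for general \<open>p\<close> is interpolated from \<open>p = 2\<close>, \<open>p = 4\<close>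
  and \<open>p = \<infinity>\<close>, and the symmetry \<open>x \<mapsto> -x\<close> reduces everything to \<open>(0, 1)\<close>.

  For \<open>p = 2\<close> the operator \<open>a \<mapsto> F\<close> is a discrete oscillatory integral operator with a fold: the mixed
  derivative \<open>1 - 2knx\<^bsup>k-1\<^esup>\<close> of the phase vanishes on a curve. Cutting sharply at distance
  \<open>\<tau> \<sim> N\<^bsup>-(k-2)/(3(k-1))\<^esup>\<close> from this curve balances the first derivative test outside against counting inside.

  For \<open>p = 4\<close>, duality reduces the bound to \<open>\<integral> |\<Sum> e(n(x-y) - n\<^sup>2(x\<^sup>k-y\<^sup>k))|\<^sup>2 dy \<lesssim> N\<^bsup>1+\<epsilon>\<^esup>\<close> uniformly in \<open>x\<close>,
  which Weyl differencing gives on dyadic intervals \<open>y \<sim> Y\<close> with \<open>Y\<^bsup>k-1\<^esup> \<gtrsim> 1/N\<close>; on the remaining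
  interval around \<open>0\<close> the fold is absent and the \<open>L\<^sup>2\<close> bound suffices.

  The bound is attained by \<open>a\<^sub>n = 1\<close> near \<open>x = 0\<close> for \<open>p \<ge> 4\<close>, and for \<open>p \<le> 4\<close> by a wave packet sitting on the
  fold, where the phase splits into a function of \<open>n\<close> and a function of \<open>x\<close> up to a cubic error.
\<close>

section \<open>Oscillatory integrals\<close>

text \<open>The exponent \<open>(k - 2) / (3 * (k - 1))\<close> arises twice from one cubic balance.
  Up to a logarithm, the region off the fold costs \<open>1 / \<tau>\<close>. In the strip around
  the fold about \<open>1 + \<tau> n\<close> frequencies meet at a point, each over a length of
  about \<open>\<tau> n^(-1/(k-1))\<close>, which costs \<open>\<tau>^2 N^(1 - 1/(k-1))\<close>. The
  costs agree when \<open>\<tau>^3 = N^(-(k-2)/(k-1))\<close>. The extremal packet has relative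
  width \<open>\<mu>\<close> in both variables and phase error of order \<open>N x0 \<mu>^3\<close>
  with \<open>x0\<close> of order \<open>N^(-1/(k-1))\<close>, so coherence forces
  \<open>\<mu>\<close> down to the size of \<open>\<tau>\<close>; hence the two bounds match.

  Sharp cutoffs are harmless because each kernel integral then runs over an interval, where the
  first derivative test applies as it stands.

  Weyl differencing cannot reach \<open>y = 0\<close>: every shift \<open>h\<close> is charged for
  some full periods of the Dirichlet kernel, which adds a term of order
  \<open>1 / (h Y^(k-1))\<close>. This stays within \<open>N\<close> up to logarithms as long as
  \<open>Y^(k-1)\<close> is at least of order \<open>1/N\<close>, and that is also the scale below
  which no \<open>n \<le> N\<close> meets the fold.\<close>

definition ch :: "real \<Rightarrow> complex" where "ch t = cis (2 * pi * t)"

lemma e_of_real: "e (of_real t) = ch t"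
  by (simp add: e_def ch_def cis_conv_exp mult_ac)

lemma norm_ch [simp]: "norm (ch t) = 1"
  by (simp add: ch_def)

lemma ch_add: "ch (s + t) = ch s * ch t"
  by (simp add: ch_def cis_mult ring_distribs)

lemma cnj_ch: "cnj (ch t) = ch (- t)"
  by (simp add: ch_def cis_cnj)

lemma ch_diff: "ch (s - t) = ch s * cnj (ch t)"
  by (simp add: cnj_ch flip: ch_add)

lemma continuous_on_ch [continuous_intros]:
  "continuous_on S f \<Longrightarrow> continuous_on S (\<lambda>x. ch (f x))"
  unfolding ch_def by (intro continuous_intros)

text \<open>A sixth of a turn has cosine 1/2; this is the source of the threshold
  \<open>1 / 6\<close> in the extremal examples.\<close>

lemma Re_ch_ge_half:
  assumes "\<bar>t\<bar> \<le> 1 / 6"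
  shows "Re (ch t) \<ge> 1 / 2"
proof -
  have "cos (pi / 3) \<le> cos \<bar>2 * pi * t\<bar>"
    using assms pi_gt_zero by (intro cos_monotone_0_pi_le) (auto simp: abs_mult)
  then show ?thesis
    by (simp add: ch_def cos_60)
qed

text \<open>Integration by parts against \<open>1 / \<psi>'\<close>. As \<open>\<psi>''\<close>
  keeps its sign, the modulus of the remainder is, up to sign, an exact derivative and integrates to
  endpoint values of \<open>1 / \<psi>'\<close>. Boundary terms and remainder cost
  \<open>2 / r\<close> each.\<close>

lemma first_derivative_test:
  fixes \<psi> \<psi>' \<psi>'' :: "real \<Rightarrow> real"
  assumes "a \<le> b" "r > 0"
    and d1: "\<And>x. x \<in> {a..b} \<Longrightarrow> (\<psi> has_real_derivative \<psi>' x) (at x within {a..b})"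
    and d2: "\<And>x. x \<in> {a..b} \<Longrightarrow> (\<psi>' has_real_derivative \<psi>'' x) (at x within {a..b})"
    and c2: "continuous_on {a..b} \<psi>''"
    and lower: "\<And>x. x \<in> {a..b} \<Longrightarrow> \<bar>\<psi>' x\<bar> \<ge> r"
    and sign: "(\<forall>x\<in>{a..b}. \<psi>'' x \<ge> 0) \<or> (\<forall>x\<in>{a..b}. \<psi>'' x \<le> 0)"
  shows "norm (integral {a..b} (\<lambda>x. cis (\<psi> x))) \<le> 4 / r"
proof -
  have nz: "\<psi>' x \<noteq> 0" if "x \<in> {a..b}" for x
    using lower[OF that] \<open>r > 0\<close> by auto
  have c0: "continuous_on {a..b} \<psi>" and c1: "continuous_on {a..b} \<psi>'"
    using DERIV_continuous_on[OF d1] DERIV_continuous_on[OF d2] by auto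
  define E where "E x = - \<i> * cis (\<psi> x) / of_real (\<psi>' x)" for x
  define R where "R x = \<i> * cis (\<psi> x) * of_real (\<psi>'' x / (\<psi>' x)\<^sup>2)" for x
  have E: "(E has_vector_derivative (cis (\<psi> x) + R x)) (at x within {a..b})" if x: "x \<in> {a..b}" for x
  proof -
    have 1: "((\<lambda>x. cis (\<psi> x)) has_vector_derivative (\<i> * cis (\<psi> x) * of_real (\<psi>' x))) (at x within {a..b})"
    proof -
      have "((\<lambda>x. \<i> * complex_of_real (\<psi> x)) has_vector_derivative \<i> * of_real (\<psi>' x)) (at x within {a..b})"
        using d1[OF x] by (intro has_vector_derivative_mult_right has_vector_derivative_of_real)
          (simp add: has_real_derivative_iff_has_vector_derivative)
      from field_vector_diff_chain_within[OF this has_field_derivative_at_within[OF DERIV_exp]]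
      show ?thesis
        by (simp add: o_def cis_conv_exp mult_ac)
    qed
    have 2: "((\<lambda>x. complex_of_real (1 / \<psi>' x)) has_vector_derivative of_real (- \<psi>'' x / (\<psi>' x)\<^sup>2)) (at x within {a..b})"
      using d2[OF x] nz[OF x]
      by (intro has_vector_derivative_of_real)
         (auto intro!: derivative_eq_intros simp flip: has_real_derivative_iff_has_vector_derivative simp: power2_eq_square)
    have "((\<lambda>x. (- \<i> * cis (\<psi> x)) * complex_of_real (1 / \<psi>' x)) has_vector_derivative
        ((- \<i> * cis (\<psi> x)) * of_real (- \<psi>'' x / (\<psi>' x)\<^sup>2) + (- \<i> * (\<i> * cis (\<psi> x) * of_real (\<psi>' x))) * complex_of_real (1 / \<psi>' x)))
        (at x within {a..b})"
      by (intro has_vector_derivative_mult 1 2 has_vector_derivative_mult_right)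
    moreover have "((- \<i> * cis (\<psi> x)) * of_real (- \<psi>'' x / (\<psi>' x)\<^sup>2) + (- \<i> * (\<i> * cis (\<psi> x) * of_real (\<psi>' x))) * complex_of_real (1 / \<psi>' x)) = cis (\<psi> x) + R x"
      using nz[OF x] by (simp add: R_def field_simps)
    ultimately show ?thesis
      by (simp add: E_def[abs_def])
  qed
  have "((\<lambda>x. cis (\<psi> x) + R x) has_integral (E b - E a)) {a..b}"
    using \<open>a \<le> b\<close> E by (rule fundamental_theorem_of_calculus)
  moreover have ci: "(\<lambda>x. cis (\<psi> x)) integrable_on {a..b}"
    by (intro integrable_continuous_interval continuous_intros c0)
  moreover have cR: "R integrable_on {a..b}"
    unfolding R_def by (intro integrable_continuous_interval continuous_intros c0 c1 c2) (use nz in auto)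
  ultimately have eq: "integral {a..b} (\<lambda>x. cis (\<psi> x)) = E b - E a - integral {a..b} R"
    by (metis add_diff_cancel_right' integral_add integral_unique)
  have nE: "norm (E x) \<le> 1 / r" if "x \<in> {a..b}" for x
    using lower[OF that] \<open>r > 0\<close> by (simp add: E_def norm_divide norm_mult frac_le)
  have inv: "\<bar>1 / \<psi>' x\<bar> \<le> 1 / r" if "x \<in> {a..b}" for x
    using lower[OF that] \<open>r > 0\<close> by (simp add: frac_le)
  have F: "((\<lambda>x. \<psi>'' x / (\<psi>' x)\<^sup>2) has_integral (- (1 / \<psi>' b) - - (1 / \<psi>' a))) {a..b}"
    using \<open>a \<le> b\<close> d2 nz
    by (intro fundamental_theorem_of_calculus)
       (auto intro!: derivative_eq_intros simp flip: has_real_derivative_iff_has_vector_derivative simp: power2_eq_square)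
  have bF: "\<bar>- (1 / \<psi>' b) - - (1 / \<psi>' a)\<bar> \<le> 2 / r"
  proof -
    have "\<bar>1 / \<psi>' a - 1 / \<psi>' b\<bar> \<le> 1 / r + 1 / r"
      using inv[of a] inv[of b] \<open>a \<le> b\<close> by (intro order_trans[OF abs_triangle_ineq4] add_mono) auto
    then show ?thesis
      by simp
  qed
  have nR: "norm (R x) = \<bar>\<psi>'' x\<bar> / (\<psi>' x)\<^sup>2" for x
    unfolding R_def norm_mult norm_of_real by simp
  have "norm (integral {a..b} R) \<le> 2 / r"
    using sign
  proof
    assume s: "\<forall>x\<in>{a..b}. \<psi>'' x \<ge> 0"
    have "norm (integral {a..b} R) \<le> integral {a..b} (\<lambda>x. \<psi>'' x / (\<psi>' x)\<^sup>2)"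
      by (rule integral_norm_bound_integral[OF cR]) (use F s in \<open>auto simp: nR\<close>)
    then show ?thesis
      using F bF by (auto simp: integral_unique)
  next
    assume s: "\<forall>x\<in>{a..b}. \<psi>'' x \<le> 0"
    have "norm (integral {a..b} R) \<le> integral {a..b} (\<lambda>x. - (\<psi>'' x / (\<psi>' x)\<^sup>2))"
      by (rule integral_norm_bound_integral[OF cR]) (use s has_integral_neg[OF F] in \<open>auto simp: nR\<close>)
    then show ?thesis
      using F bF by (auto simp: integral_unique)
  qed
  moreover have "norm (E b) \<le> 1 / r" "norm (E a) \<le> 1 / r"
    using nE \<open>a \<le> b\<close> by auto
  ultimately show ?thesis
    unfolding eq using norm_triangle_ineq4[of "E b - E a" "integral {a..b} R"] norm_triangle_ineq4[of "E b" "E a"] by simp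
qed

text \<open>On \<open>x \<ge> 0\<close> the second derivative of the phase has the constant sign of
  \<open>- h * s\<close>, so the first derivative test only has to be fed a lower bound for the
  derivative. The factor 4 is absorbed by \<open>2 * pi\<close>.\<close>

lemma kernel_bound:
  fixes k :: nat and h s \<tau> :: real
  assumes "k \<ge> 2" "\<tau> > 0" "h \<noteq> 0" "0 \<le> a"
    and lower: "\<And>x. x \<in> {a..b} \<Longrightarrow> \<bar>1 - real k * s * x ^ (k - 1)\<bar> \<ge> \<tau>"
  shows "norm (integral {a..b} (\<lambda>x. ch (h * (x - s * x ^ k)))) \<le> 1 / (\<bar>h\<bar> * \<tau>)"
proof (cases "a \<le> b")
  case True
  define c where "c = 2 * pi * h"
  have "norm (integral {a..b} (\<lambda>x. cis (c * (x - s * x ^ k)))) \<le> 4 / (2 * pi * (\<bar>h\<bar> * \<tau>))"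
  proof (rule first_derivative_test[where \<psi>' = "\<lambda>x. c * (1 - real k * s * x ^ (k - 1))"
        and \<psi>'' = "\<lambda>x. - c * s * real (k * (k - 1)) * x ^ (k - 2)"])
    show "2 * pi * (\<bar>h\<bar> * \<tau>) > 0"
      using assms by simp
    show "((\<lambda>x. c * (x - s * x ^ k)) has_real_derivative c * (1 - real k * s * x ^ (k - 1))) (at x within {a..b})" for x
      by (auto intro!: derivative_eq_intros simp: algebra_simps)
    show "((\<lambda>x. c * (1 - real k * s * x ^ (k - 1))) has_real_derivative - c * s * real (k * (k - 1)) * x ^ (k - 2)) (at x within {a..b})" for x
      using \<open>k \<ge> 2\<close> by (auto intro!: derivative_eq_intros simp: algebra_simps numeral_2_eq_2 diff_Suc split: nat.splits)
    show "2 * pi * (\<bar>h\<bar> * \<tau>) \<le> \<bar>c * (1 - real k * s * x ^ (k - 1))\<bar>" if "x \<in> {a..b}" for x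
      using lower[OF that] assms by (simp add: c_def abs_mult)
    show "(\<forall>x\<in>{a..b}. 0 \<le> - c * s * real (k * (k - 1)) * x ^ (k - 2)) \<or>
          (\<forall>x\<in>{a..b}. - c * s * real (k * (k - 1)) * x ^ (k - 2) \<le> 0)"
    proof (cases "c * s \<ge> 0")
      case True
      then have "- (c * s) * (real (k * (k - 1)) * x ^ (k - 2)) \<le> 0" if "x \<in> {a..b}" for x
        using that \<open>0 \<le> a\<close> by (intro mult_nonpos_nonneg mult_nonneg_nonneg zero_le_power) auto
      then show ?thesis
        by (simp add: mult.assoc)
    next
      case False
      then have "0 \<le> - (c * s) * (real (k * (k - 1)) * x ^ (k - 2))" if "x \<in> {a..b}" for x
        using that \<open>0 \<le> a\<close> by (intro mult_nonneg_nonneg zero_le_power) auto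
      then show ?thesis
        by (simp add: mult.assoc)
    qed
  qed (use True in \<open>auto intro!: continuous_intros\<close>)
  also have "\<dots> \<le> 1 / (\<bar>h\<bar> * \<tau>)"
    using assms pi_ge_two by (simp add: field_simps)
  finally show ?thesis
    by (simp add: ch_def c_def mult_ac)
qed (use assms in auto)

section \<open>The bound for \<open>p = 2\<close>\<close>

lemma schur_test:
  fixes a :: "'i \<Rightarrow> complex" and K :: "'i \<Rightarrow> 'i \<Rightarrow> complex" and b :: "'i \<Rightarrow> 'i \<Rightarrow> real"
  assumes K: "\<And>n m. n \<in> A \<Longrightarrow> m \<in> A \<Longrightarrow> norm (K n m) \<le> b n m"
    and sym: "\<And>n m. b n m = b m n"
    and row: "\<And>n. n \<in> A \<Longrightarrow> (\<Sum>m\<in>A. b n m) \<le> B"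
  shows "norm (\<Sum>n\<in>A. \<Sum>m\<in>A. a n * cnj (a m) * K n m) \<le> B * (\<Sum>n\<in>A. (norm (a n))\<^sup>2)"
proof -
  have dbl: "(x + x) / 2 = x" for x :: real
    by simp
  have "norm (\<Sum>n\<in>A. \<Sum>m\<in>A. a n * cnj (a m) * K n m)
      \<le> (\<Sum>n\<in>A. \<Sum>m\<in>A. ((norm (a n))\<^sup>2 * b n m + (norm (a m))\<^sup>2 * b m n) / 2)"
  proof (intro sum_norm_le)
    fix n m assume nm: "n \<in> A" "m \<in> A"
    have "norm (a n * cnj (a m) * K n m) \<le> (norm (a n) * norm (a m)) * b n m"
      using K[OF nm] by (simp add: norm_mult mult_left_mono)
    also have "\<dots> \<le> (((norm (a n))\<^sup>2 + (norm (a m))\<^sup>2) / 2) * b n m"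
      using sum_squares_bound[of "norm (a n)" "norm (a m)"] order_trans[OF norm_ge_zero K[OF nm]]
      by (intro mult_right_mono) auto
    finally show "norm (a n * cnj (a m) * K n m) \<le> ((norm (a n))\<^sup>2 * b n m + (norm (a m))\<^sup>2 * b m n) / 2"
      using sym[of n m] by (simp add: field_simps)
  qed
  also have "\<dots> = ((\<Sum>n\<in>A. \<Sum>m\<in>A. (norm (a n))\<^sup>2 * b n m) + (\<Sum>n\<in>A. \<Sum>m\<in>A. (norm (a m))\<^sup>2 * b m n)) / 2"
    by (simp add: sum.distrib flip: sum_divide_distrib)
  also have "(\<Sum>n\<in>A. \<Sum>m\<in>A. (norm (a m))\<^sup>2 * b m n) = (\<Sum>n\<in>A. \<Sum>m\<in>A. (norm (a n))\<^sup>2 * b n m)"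
    by (rule sum.swap)
  also have "((\<Sum>n\<in>A. \<Sum>m\<in>A. (norm (a n))\<^sup>2 * b n m) + (\<Sum>n\<in>A. \<Sum>m\<in>A. (norm (a n))\<^sup>2 * b n m)) / 2
      = (\<Sum>n\<in>A. (norm (a n))\<^sup>2 * (\<Sum>m\<in>A. b n m))"
    unfolding sum_distrib_left by (rule dbl)
  also have "\<dots> \<le> (\<Sum>n\<in>A. (norm (a n))\<^sup>2 * B)"
    by (intro sum_mono mult_left_mono row) auto
  also have "\<dots> = B * (\<Sum>n\<in>A. (norm (a n))\<^sup>2)"
    by (simp add: sum_distrib_left mult.commute)
  finally show ?thesis .
qed

lemma sum_inverse_inj_le_harm:
  fixes g :: "'i \<Rightarrow> nat"
  assumes "inj_on g B" "g ` B \<subseteq> {1..M}"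
  shows "(\<Sum>i\<in>B. 1 / real (g i)) \<le> harm M"
proof -
  have "(\<Sum>i\<in>B. 1 / real (g i)) = (\<Sum>j\<in>g ` B. 1 / real j)"
    using assms(1) by (simp add: sum.reindex)
  also have "\<dots> \<le> (\<Sum>j\<in>{1..M}. 1 / real j)"
    using assms(2) by (intro sum_mono2) auto
  finally show ?thesis
    by (simp add: harm_def field_simps)
qed

lemma sum_inverse_diff_le_harm:
  fixes n :: int
  assumes "n \<in> {- int N..int N}"
  shows "(\<Sum>m\<in>{- int N..int N} - {n}. 1 / \<bar>real_of_int n - real_of_int m\<bar>) \<le> 2 * harm (2 * N)"
proof -
  have split: "{- int N..int N} - {n} = {- int N..<n} \<union> {n<..int N}"
    using assms by auto
  have "(\<Sum>m\<in>{- int N..<n}. 1 / \<bar>real_of_int n - real_of_int m\<bar>)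
      = (\<Sum>m\<in>{- int N..<n}. 1 / real (nat (n - m)))"
    by (intro sum.cong) auto
  also have "\<dots> \<le> harm (2 * N)"
    using assms by (intro sum_inverse_inj_le_harm) (auto simp: inj_on_def)
  finally have 1: "(\<Sum>m\<in>{- int N..<n}. 1 / \<bar>real_of_int n - real_of_int m\<bar>) \<le> harm (2 * N)" .
  have "(\<Sum>m\<in>{n<..int N}. 1 / \<bar>real_of_int n - real_of_int m\<bar>)
      = (\<Sum>m\<in>{n<..int N}. 1 / real (nat (m - n)))"
    by (intro sum.cong) auto
  also have "\<dots> \<le> harm (2 * N)"
    using assms by (intro sum_inverse_inj_le_harm) (auto simp: inj_on_def)
  finally have 2: "(\<Sum>m\<in>{n<..int N}. 1 / \<bar>real_of_int n - real_of_int m\<bar>) \<le> harm (2 * N)" .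
  show ?thesis
    unfolding split using 1 2 by (subst sum.union_disjoint) auto
qed

section \<open>The quadratic form of the sum and its off-fold estimate\<close>

definition osc :: "nat \<Rightarrow> int \<Rightarrow> real \<Rightarrow> complex" where
  "osc k n x = ch (of_int n * x - (of_int n)\<^sup>2 * x ^ k)"

lemma exp_sum_osc: "exp_sum k N a x = (\<Sum>n\<in>{- int N..int N}. a n * osc k n x)"
  by (simp only: exp_sum_def osc_def e_of_real)

lemma norm_osc [simp]: "norm (osc k n x) = 1"
  by (simp add: osc_def)

lemma continuous_on_osc [continuous_intros]: "continuous_on S (osc k n)"
  unfolding osc_def by (intro continuous_intros)

text \<open>Factoring \<open>n^2 - m^2\<close> pulls out \<open>n - m\<close> and gives the phase
  the shape required by \<open>kernel_bound\<close>, with \<open>h = n - m\<close> and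
  \<open>s = n + m\<close>.\<close>

lemma osc_mult_cnj: "osc k n x * cnj (osc k m x) = ch (of_int (n - m) * (x - of_int (n + m) * x ^ k))"
  unfolding osc_def by (simp add: algebra_simps power2_eq_square flip: ch_diff)

text \<open>Each frequency lives on its own interval, possibly empty, that stays on one side of the
  fold; \<open>\<sigma>\<close> names the side. Expanding the square gives kernels over
  intersections of intervals, of size at most \<open>1 / (\<bar>n - m\<bar> * \<tau>)\<close> off
  the diagonal, and Schur's test sums these to a harmonic number over \<open>\<tau>\<close>.\<close>

lemma cutoff_l2_bound:
  fixes k N :: nat and l u :: "int \<Rightarrow> real" and a :: "int \<Rightarrow> complex"
  defines "F \<equiv> \<lambda>x. \<Sum>n\<in>{- int N..int N}. if x \<in> {l n..u n} then a n * osc k n x else 0"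
  assumes "k \<ge> 2" "\<tau> > 0" "\<bar>\<sigma>\<bar> = 1"
    and range: "\<And>n. n \<in> {- int N..int N} \<Longrightarrow> 0 \<le> l n \<and> u n \<le> 1"
    and lower: "\<And>n x. n \<in> {- int N..int N} \<Longrightarrow> x \<in> {l n..u n} \<Longrightarrow>
        \<sigma> * (1 - 2 * real k * of_int n * x ^ (k - 1)) \<ge> \<tau>"
  shows "(\<lambda>x. (norm (F x))\<^sup>2) integrable_on {0..1}"
    and "integral {0..1} (\<lambda>x. (norm (F x))\<^sup>2) \<le> (1 + 2 * harm (2 * N) / \<tau>) * (\<Sum>n\<in>{- int N..int N}. (norm (a n))\<^sup>2)"
proof -
  let ?A = "{- int N..int N}"
  define K where "K n m = integral {max (l n) (l m)..min (u n) (u m)}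
      (\<lambda>x. ch (of_int (n - m) * (x - of_int (n + m) * x ^ k)))" for n m
  have K_int: "((\<lambda>x. if x \<in> {max (l n) (l m)..min (u n) (u m)} then
        ch (of_int (n - m) * (x - of_int (n + m) * x ^ k)) else 0) has_integral K n m) {0..1}"
    if "n \<in> ?A" "m \<in> ?A" for n m
    using range[OF that(1)] range[OF that(2)] unfolding K_def
    by (subst has_integral_restrict)
       (auto intro!: integrable_integral integrable_continuous_interval continuous_intros)
  have expand: "complex_of_real ((norm (F x))\<^sup>2) = (\<Sum>n\<in>?A. \<Sum>m\<in>?A. a n * cnj (a m) *
      (if x \<in> {max (l n) (l m)..min (u n) (u m)} then
        ch (of_int (n - m) * (x - of_int (n + m) * x ^ k)) else 0))" for x
  proof -
    have "complex_of_real ((norm (F x))\<^sup>2) = F x * cnj (F x)"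
      by (rule complex_norm_square)
    also have "\<dots> = (\<Sum>n\<in>?A. \<Sum>m\<in>?A. (if x \<in> {l n..u n} then a n * osc k n x else 0) *
        cnj (if x \<in> {l m..u m} then a m * osc k m x else 0))"
      unfolding F_def by (simp only: cnj_sum sum_product)
    also have "\<dots> = (\<Sum>n\<in>?A. \<Sum>m\<in>?A. a n * cnj (a m) *
      (if x \<in> {max (l n) (l m)..min (u n) (u m)} then
        ch (of_int (n - m) * (x - of_int (n + m) * x ^ k)) else 0))"
      by (intro sum.cong refl) (auto simp flip: osc_mult_cnj simp del: of_int_diff of_int_add)
    finally show ?thesis .
  qed
  have cint: "((\<lambda>x. complex_of_real ((norm (F x))\<^sup>2)) has_integral
      (\<Sum>n\<in>?A. \<Sum>m\<in>?A. a n * cnj (a m) * K n m)) {0..1}"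
    unfolding expand by (intro has_integral_sum has_integral_mult_right K_int) auto
  have rint: "((\<lambda>x. (norm (F x))\<^sup>2) has_integral
      Re (\<Sum>n\<in>?A. \<Sum>m\<in>?A. a n * cnj (a m) * K n m)) {0..1}"
    using has_integral_linear[OF cint bounded_linear_Re] by (simp add: o_def)
  then show "(\<lambda>x. (norm (F x))\<^sup>2) integrable_on {0..1}"
    by blast
  define b where "b n m = (if n = m then 1 else 1 / (\<bar>real_of_int n - real_of_int m\<bar> * \<tau>))" for n m
  have "norm (\<Sum>n\<in>?A. \<Sum>m\<in>?A. a n * cnj (a m) * K n m)
      \<le> (1 + 2 * harm (2 * N) / \<tau>) * (\<Sum>n\<in>?A. (norm (a n))\<^sup>2)"
  proof (rule schur_test[where b = b])
    fix n m assume nm: "n \<in> ?A" "m \<in> ?A"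
    show "norm (K n m) \<le> b n m"
    proof (cases "n = m")
      case True
      have "norm (K n n) \<le> 1 * (u n - l n)" if "l n \<le> u n"
        unfolding K_def max.idem min.idem
        using that by (intro integral_bound) (auto intro!: continuous_intros)
      then show ?thesis
        using range[OF nm(1)] True by (cases "l n \<le> u n") (auto simp: b_def K_def)
    next
      case False
      have "norm (K n m) \<le> 1 / (\<bar>of_int (n - m)\<bar> * \<tau>)"
        unfolding K_def
      proof (rule kernel_bound)
        fix x assume x: "x \<in> {max (l n) (l m)..min (u n) (u m)}"
        \<comment> \<open>The factor for the pair is the mean of the factors for \<open>n\<close>
          and for \<open>m\<close>. Since both have the sign \<open>\<sigma>\<close>, they cannot
          cancel in the mean.\<close>
        have "\<sigma> * (1 - real k * of_int (n + m) * x ^ (k - 1)) \<ge> \<tau>"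
          using lower[OF nm(1), of x] lower[OF nm(2), of x] x by (auto simp: algebra_simps)
        also have "\<sigma> * (1 - real k * of_int (n + m) * x ^ (k - 1)) \<le> \<bar>\<sigma> * (1 - real k * of_int (n + m) * x ^ (k - 1))\<bar>"
          by (rule abs_ge_self)
        finally show "\<bar>1 - real k * of_int (n + m) * x ^ (k - 1)\<bar> \<ge> \<tau>"
          using \<open>\<bar>\<sigma>\<bar> = 1\<close> by (simp add: abs_mult)
      qed (use assms False range[OF nm(1)] range[OF nm(2)] in auto)
      then show ?thesis
        using False by (simp add: b_def)
    qed
  next
    show "b n m = b m n" for n m
      by (simp add: b_def abs_minus_commute)
  next
    fix n assume n: "n \<in> ?A"
    have "(\<Sum>m\<in>?A. b n m) = b n n + (\<Sum>m\<in>?A - {n}. b n m)"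
      using n by (subst sum.remove[where x = n]) auto
    also have "(\<Sum>m\<in>?A - {n}. b n m) = (\<Sum>m\<in>?A - {n}. 1 / \<bar>real_of_int n - real_of_int m\<bar>) / \<tau>"
      unfolding sum_divide_distrib by (intro sum.cong) (auto simp: b_def)
    also have "\<dots> \<le> 2 * harm (2 * N) / \<tau>"
      using sum_inverse_diff_le_harm[OF n] \<open>\<tau> > 0\<close> by (intro divide_right_mono) auto
    finally show "(\<Sum>m\<in>?A. b n m) \<le> 1 + 2 * harm (2 * N) / \<tau>"
      by (simp add: b_def)
  qed
  then show "integral {0..1} (\<lambda>x. (norm (F x))\<^sup>2) \<le> (1 + 2 * harm (2 * N) / \<tau>) * (\<Sum>n\<in>?A. (norm (a n))\<^sup>2)"
    unfolding integral_unique[OF rint] by (meson complex_Re_le_cmod order_trans)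
qed

text \<open>So close to 0 the derivative factor is at least 1/2 for every \<open>n\<close> at once,
  so a single common interval with \<open>\<tau> = 1 / 2\<close> works and only a logarithm is
  lost.\<close>

lemma inner_l2_bound:
  fixes a :: "int \<Rightarrow> complex"
  assumes "k \<ge> 2" "0 \<le> t" "t \<le> 1" "4 * real k * real N * t ^ (k - 1) \<le> 1"
  shows "integral {0..t} (\<lambda>x. (norm (exp_sum k N a x))\<^sup>2)
      \<le> (1 + 4 * harm (2 * N)) * (\<Sum>n\<in>{- int N..int N}. (norm (a n))\<^sup>2)"
proof -
  let ?A = "{- int N..int N}"
  define F where "F x = (\<Sum>n\<in>?A. if x \<in> {0..t} then a n * osc k n x else 0)" for x
  have "integral {0..1} (\<lambda>x. (norm (F x))\<^sup>2) \<le> (1 + 2 * harm (2 * N) / (1 / 2)) * (\<Sum>n\<in>?A. (norm (a n))\<^sup>2)"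
    unfolding F_def
  proof (rule cutoff_l2_bound[where \<sigma> = 1])
    fix n x assume n: "n \<in> ?A" and x: "x \<in> {0..t}"
    have "2 * real k * of_int n * x ^ (k - 1) \<le> 2 * real k * real N * t ^ (k - 1)"
      using n x by (intro mult_mono power_mono mult_left_mono) auto
    also have "\<dots> = (4 * real k * real N * t ^ (k - 1)) / 2"
      by simp
    also have "\<dots> \<le> 1 / 2"
      using assms(4) by (rule divide_right_mono) simp
    finally show "1 / 2 \<le> 1 * (1 - 2 * real k * real_of_int n * x ^ (k - 1))"
      by simp
  qed (use assms in auto)
  also have "(\<lambda>x. (norm (F x))\<^sup>2) = (\<lambda>x. if x \<in> {0..t} then (norm (exp_sum k N a x))\<^sup>2 else 0)"
    by (auto simp: F_def exp_sum_osc fun_eq_iff)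
  also have "integral {0..1} (\<lambda>x. if x \<in> {0..t} then (norm (exp_sum k N a x))\<^sup>2 else 0) =
      integral {0..t} (\<lambda>x. (norm (exp_sum k N a x))\<^sup>2)"
    using assms by (simp only: integral_restrict_Int) (simp add: Int_absorb2)
  finally show ?thesis
    by simp
qed

section \<open>Counting frequencies near the fold\<close>

lemma powr_inverse_power:
  fixes y :: real
  assumes "k \<ge> 2" "y > 0"
  shows "(y powr (1 / real (k - 1))) ^ (k - 1) = y"
proof -
  have "(y powr (1 / real (k - 1))) ^ (k - 1) = (y powr (1 / real (k - 1))) powr real (k - 1)"
    by (intro powr_realpow[symmetric]) (use assms in auto)
  also have "\<dots> = y"
    using assms by (simp add: powr_powr)
  finally show ?thesis .
qed

lemma card_int_le_diameter:
  fixes P :: "int set" and d :: real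
  assumes "finite P" "d \<ge> 0" and diam: "\<And>n m. n \<in> P \<Longrightarrow> m \<in> P \<Longrightarrow> real_of_int (n - m) \<le> d"
  shows "real (card P) \<le> 1 + d"
proof (cases "P = {}")
  case False
  have "card P \<le> card {Min P..Max P}"
    using \<open>finite P\<close> by (intro card_mono) auto
  moreover have "Min P \<le> Max P"
    using \<open>finite P\<close> False by (meson Max_ge Min_in)
  ultimately have "real (card P) \<le> real_of_int (Max P - Min P + 1)"
    by simp
  also have "\<dots> \<le> 1 + d"
    using diam[of "Max P" "Min P"] \<open>finite P\<close> False by simp
  finally show ?thesis .
qed (use assms in auto)

lemma norm_add3_squared:
  fixes x y z :: complex
  shows "(norm (x + y + z))\<^sup>2 \<le> 3 * ((norm x)\<^sup>2 + (norm y)\<^sup>2 + (norm z)\<^sup>2)"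
proof -
  have "(norm (x + y + z))\<^sup>2 \<le> (norm x + norm y + norm z)\<^sup>2"
    by (intro power_mono norm_triangle_le add_mono norm_triangle_ineq) auto
  also have "\<dots> \<le> 3 * ((norm x)\<^sup>2 + (norm y)\<^sup>2 + (norm z)\<^sup>2)"
    using sum_squares_bound[of "norm x" "norm y"] sum_squares_bound[of "norm x" "norm z"]
      sum_squares_bound[of "norm y" "norm z"] by (simp add: power2_eq_square algebra_simps)
  finally show ?thesis .
qed

lemma norm_sum_squared_le_card:
  fixes f :: "'i \<Rightarrow> complex"
  shows "(norm (sum f P))\<^sup>2 \<le> real (card P) * (\<Sum>n\<in>P. (norm (f n))\<^sup>2)"
proof -
  have "(norm (sum f P))\<^sup>2 \<le> (\<Sum>n\<in>P. 1 * norm (f n))\<^sup>2"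
    by (intro power_mono) (auto intro: norm_sum)
  also have "\<dots> \<le> (\<Sum>n\<in>P. 1\<^sup>2) * (\<Sum>n\<in>P. (norm (f n))\<^sup>2)"
    by (rule Cauchy_Schwarz_ineq_sum)
  finally show ?thesis
    by simp
qed

text \<open>In the \<open>\<tau>\<close>-neighbourhood of the fold, few \<open>n\<close> meet a given \<open>x\<close> and the \<open>x\<close>-intervals are short.\<close>

lemma l2_bound_cutoff:
  fixes a :: "int \<Rightarrow> complex"
  assumes "k \<ge> 2" "N \<ge> 1" "0 < \<tau>" "\<tau> \<le> 1 / 2"
  shows "integral {0..1} (\<lambda>x. (norm (exp_sum k N a x))\<^sup>2)
      \<le> 3 * (3 + 4 * harm (2 * N) / \<tau> + 8 * \<tau>\<^sup>2 * real N powr (1 - 1 / real (k - 1)))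
          * (\<Sum>n\<in>{- int N..int N}. (norm (a n))\<^sup>2)"
proof -
  let ?A = "{- int N..int N}"
  let ?S = "\<Sum>n\<in>?A. (norm (a n))\<^sup>2"
  define r where "r = 1 / real (k - 1)"
  have r: "0 < r" "r \<le> 1"
    using \<open>k \<ge> 2\<close> by (auto simp: r_def)
  \<comment> \<open>For \<open>n \<ge> 1\<close>, \<open>u n\<close> and \<open>v n\<close> are the
    points where \<open>1 - 2 * k * n * x^(k-1)\<close> equals \<open>\<tau>\<close> and
    \<open>- \<tau>\<close>. For \<open>n \<le> 0\<close> there is no fold on \<open>[0, 1]\<close>:
    the value 1 puts the whole interval on the lower side, and the value 2 makes the upper interval
    \<open>{v n..1}\<close> empty.\<close>
  define u where "u n = (if n \<ge> 1 then ((1 - \<tau>) / (2 * real k * of_int n)) powr r else 1)" for n :: int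
  define v where "v n = (if n \<ge> 1 then ((1 + \<tau>) / (2 * real k * of_int n)) powr r else 2)" for n :: int
  have upow: "(u n) ^ (k - 1) = (1 - \<tau>) / (2 * real k * of_int n)" if "n \<ge> 1" for n
    using powr_inverse_power[OF \<open>k \<ge> 2\<close>, of "(1 - \<tau>) / (2 * real k * of_int n)"] that assms
    by (simp add: u_def r_def)
  have vpow: "(v n) ^ (k - 1) = (1 + \<tau>) / (2 * real k * of_int n)" if "n \<ge> 1" for n
    using powr_inverse_power[OF \<open>k \<ge> 2\<close>, of "(1 + \<tau>) / (2 * real k * of_int n)"] that assms
    by (simp add: v_def r_def)
  have u0: "u n \<ge> 0" for n
    by (simp add: u_def)
  have v0: "v n \<ge> 0" for n
    by (simp add: v_def)
  have kn: "2 * real k * of_int n \<ge> 4" if "n \<ge> 1" for n :: int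
    using mult_mono[of 4 "2 * real k" 1 "of_int n"] that \<open>k \<ge> 2\<close> by simp
  have u1: "u n \<le> 1" for n
  proof (cases "n \<ge> 1")
    case True
    have "1 - \<tau> \<le> 2 * real k * of_int n"
      using kn[OF True] \<open>0 < \<tau>\<close> by linarith
    then have "(1 - \<tau>) / (2 * real k * of_int n) \<le> 1"
      using kn[OF True] by (subst divide_le_eq_1_pos) linarith+
    moreover have "(1 - \<tau>) / (2 * real k * of_int n) \<ge> 0"
      using True assms by simp
    ultimately show ?thesis
      using True r powr_le1[of r "(1 - \<tau>) / (2 * real k * of_int n)"] by (simp add: u_def)
  qed (simp add: u_def)
  have v1: "v n \<le> 1" if "n \<ge> 1" for n
  proof -
    have "1 + \<tau> \<le> 2 * real k * of_int n"
      using kn[OF that] \<open>\<tau> \<le> 1 / 2\<close> by linarith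
    then have "(1 + \<tau>) / (2 * real k * of_int n) \<le> 1"
      using kn[OF that] by (subst divide_le_eq_1_pos) linarith+
    moreover have "(1 + \<tau>) / (2 * real k * of_int n) \<ge> 0"
      using that assms by simp
    ultimately show ?thesis
      using that r powr_le1[of r "(1 + \<tau>) / (2 * real k * of_int n)"] by (simp add: v_def)
  qed
  have uv: "u n < v n" for n
    using kn[of n] assms r by (auto simp: u_def v_def intro!: powr_less_mono2 divide_strict_right_mono)
  \<comment> \<open>For \<open>0 < r \<le> 1\<close> one has
    \<open>(1 + \<tau>)^r \<le> 1 + \<tau>\<close> and
    \<open>(1 - \<tau>)^r \<ge> 1 - \<tau>\<close>, so the numerators of \<open>v n\<close> and
    \<open>u n\<close> differ by at most \<open>2 * \<tau>\<close>.\<close>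
  have len: "v n - u n \<le> 2 * \<tau> * of_int n powr - r" if "n \<ge> 1" for n
  proof -
    have "(1 + \<tau>) powr r \<le> (1 + \<tau>) powr 1"
      using assms r by (intro powr_mono) auto
    moreover have "(1 - \<tau>) powr 1 \<le> (1 - \<tau>) powr r"
      using assms r by (intro powr_mono') auto
    ultimately have "(1 + \<tau>) powr r - (1 - \<tau>) powr r \<le> 2 * \<tau>"
      using assms by simp
    moreover have "of_int n powr r \<le> (2 * real k * of_int n) powr r"
      using that \<open>k \<ge> 2\<close> r by (intro powr_mono2) auto
    ultimately have "((1 + \<tau>) powr r - (1 - \<tau>) powr r) / (2 * real k * of_int n) powr r \<le> 2 * \<tau> / of_int n powr r"
      using that assms by (intro frac_le) auto
    moreover have "v n - u n = ((1 + \<tau>) powr r - (1 - \<tau>) powr r) / (2 * real k * of_int n) powr r"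
      using that assms by (simp only: u_def v_def if_True) (simp add: powr_divide flip: diff_divide_distrib)
    moreover have "2 * \<tau> / of_int n powr r = 2 * \<tau> * of_int n powr - r"
      by (simp add: powr_minus divide_inverse)
    ultimately show ?thesis
      by simp
  qed
  define F1 where "F1 x = (\<Sum>n\<in>?A. if x \<in> {0..u n} then a n * osc k n x else 0)" for x
  define F2 where "F2 x = (\<Sum>n\<in>?A. if x \<in> {v n..1} then a n * osc k n x else 0)" for x
  define F3 where "F3 x = (\<Sum>n\<in>?A. if u n < x \<and> x < v n then a n * osc k n x else 0)" for x
  \<comment> \<open>The weight in front of \<open>\<bar>a n\<bar>^2\<close> bounds the number of
    frequencies that can be in the strip together with \<open>n\<close>. With it \<open>G\<close>
    majorizes \<open>\<bar>F3\<bar>^2\<close> pointwise and is a step function that integrates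
    exactly.\<close>
  define W where "W n = (if n \<ge> 1 then (1 + 4 * \<tau> * of_int n) * (norm (a n))\<^sup>2 else 0)" for n :: int
  define G where "G x = (\<Sum>n\<in>?A. if x \<in> {u n..min 1 (v n)} then W n else 0)" for x
  have W0: "W n \<ge> 0" for n
    using assms by (auto simp: W_def)
  have split: "exp_sum k N a x = F1 x + F2 x + F3 x" if "x \<in> {0..1}" for x
  proof -
    have "a n * osc k n x = (if x \<in> {0..u n} then a n * osc k n x else 0) +
        (if x \<in> {v n..1} then a n * osc k n x else 0) +
        (if u n < x \<and> x < v n then a n * osc k n x else 0)" for n
      using that uv[of n] by auto
    then show ?thesis
      unfolding exp_sum_osc F1_def F2_def F3_def sum.distrib[symmetric] by (rule sum.cong[OF refl])
  qed
  have F3: "(norm (F3 x))\<^sup>2 \<le> G x" if x: "x \<in> {0..1}" for x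
  proof -
    define P where "P = {n \<in> ?A. u n < x \<and> x < v n}"
    have P1: "n \<ge> 1" if "n \<in> P" for n
      using that x by (auto simp: P_def u_def split: if_splits)
    have Pb: "1 - \<tau> < 2 * real k * of_int n * x ^ (k - 1)" "2 * real k * of_int n * x ^ (k - 1) < 1 + \<tau>"
      if "n \<in> P" for n
    proof -
      have "(u n) ^ (k - 1) < x ^ (k - 1)" "x ^ (k - 1) < (v n) ^ (k - 1)"
        using that \<open>k \<ge> 2\<close> u0[of n] v0[of n] x by (auto simp: P_def intro!: power_strict_mono)
      moreover have "2 * real k * of_int n > 0"
        using kn[OF P1[OF that]] by linarith
      ultimately show "1 - \<tau> < 2 * real k * of_int n * x ^ (k - 1)" "2 * real k * of_int n * x ^ (k - 1) < 1 + \<tau>"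
        unfolding upow[OF P1[OF that]] vpow[OF P1[OF that]]
        by (simp_all only: pos_divide_less_eq pos_less_divide_eq mult.commute)
    qed
    \<comment> \<open>With \<open>X = 2 * k * x^(k-1)\<close>, all \<open>m * X\<close> for
      \<open>m\<close> in \<open>P\<close> lie within \<open>\<tau>\<close> of 1, so
      \<open>P\<close> has diameter at most \<open>2 * \<tau> / X\<close>. One member satisfies
      \<open>n * X \<ge> 1 / 2\<close>, which trades \<open>1 / X\<close> for
      \<open>2 * n\<close>.\<close>
    have card: "real (card P) \<le> 1 + 4 * \<tau> * of_int n" if n: "n \<in> P" for n
    proof (rule card_int_le_diameter)
      define X where "X = 2 * real k * x ^ (k - 1)"
      fix m l assume ml: "m \<in> P" "l \<in> P"
      have nX: "of_int n * X \<ge> 1 / 2"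
        using Pb(1)[OF n] \<open>\<tau> \<le> 1 / 2\<close> by (simp add: X_def mult_ac)
      then have "X > 0"
        using P1[OF n] zero_less_mult_pos[of "of_int n" X] by simp
      have "of_int (m - l) * X \<le> 2 * \<tau>"
        using Pb(2)[OF ml(1)] Pb(1)[OF ml(2)] by (simp add: X_def algebra_simps)
      also have "2 * \<tau> \<le> 4 * \<tau> * of_int n * X"
        using \<open>\<tau> > 0\<close> mult_left_mono[OF nX, of "4 * \<tau>"] by (simp add: mult.assoc)
      finally show "of_int (m - l) \<le> 4 * \<tau> * of_int n"
        using \<open>X > 0\<close> by simp
    next
      show "finite P"
        unfolding P_def by (intro finite_Collect_conjI) simp
      show "0 \<le> 4 * \<tau> * of_int n"
        using P1[OF n] \<open>\<tau> > 0\<close> by simp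
    qed
    have "F3 x = (\<Sum>n\<in>P. a n * osc k n x)"
      unfolding F3_def P_def by (intro sum.inter_filter[symmetric]) simp
    also have "(norm \<dots>)\<^sup>2 \<le> real (card P) * (\<Sum>n\<in>P. (norm (a n * osc k n x))\<^sup>2)"
      by (rule norm_sum_squared_le_card)
    also have "\<dots> = (\<Sum>n\<in>P. real (card P) * (norm (a n))\<^sup>2)"
      by (simp add: sum_distrib_left norm_mult)
    also have "\<dots> \<le> (\<Sum>n\<in>P. W n)"
      using card P1 by (intro sum_mono) (auto simp: W_def intro!: mult_right_mono)
    also have "\<dots> = (\<Sum>n\<in>?A. if u n < x \<and> x < v n then W n else 0)"
      unfolding P_def by (intro sum.inter_filter) simp
    also have "\<dots> \<le> G x"
      unfolding G_def using W0 x by (intro sum_mono) auto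
    finally show ?thesis .
  qed
  have G_int: "(G has_integral (\<Sum>n\<in>?A. (min 1 (v n) - u n) * W n)) {0..1}"
    unfolding G_def
  proof (intro has_integral_sum)
    fix n assume "n \<in> ?A"
    have "((\<lambda>x. W n) has_integral (min 1 (v n) - u n) * W n) {u n..min 1 (v n)}"
      using has_integral_const_real[of "W n" "u n" "min 1 (v n)"] uv[of n] u1[of n] by simp
    then show "((\<lambda>x. if x \<in> {u n..min 1 (v n)} then W n else 0) has_integral (min 1 (v n) - u n) * W n) {0..1}"
      using u0[of n] by (subst has_integral_restrict) auto
  qed auto
  have G_le: "(\<Sum>n\<in>?A. (min 1 (v n) - u n) * W n) \<le> (1 + 8 * \<tau>\<^sup>2 * real N powr (1 - r)) * ?S"
    unfolding sum_distrib_left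
  proof (intro sum_mono)
    fix n assume n: "n \<in> ?A"
    show "(min 1 (v n) - u n) * W n \<le> (1 + 8 * \<tau>\<^sup>2 * real N powr (1 - r)) * (norm (a n))\<^sup>2"
    proof (cases "n \<ge> 1")
      case True
      \<comment> \<open>Length times multiplicity. The summand 1 of the multiplicity only needs
        \<open>v n - u n \<le> 1\<close>; the other summand uses the short length and produces
        \<open>\<tau>^2 n^(1-r)\<close>.\<close>
      have "(v n - u n) * (1 + 4 * \<tau> * of_int n) = (v n - u n) + 4 * \<tau> * of_int n * (v n - u n)"
        by (simp add: algebra_simps)
      also have "\<dots> \<le> 1 + 4 * \<tau> * of_int n * (2 * \<tau> * of_int n powr - r)"
        using len[OF True] v1[OF True] u0[of n] True assms
        by (intro add_mono mult_left_mono) auto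
      also have "\<dots> = 1 + 8 * \<tau>\<^sup>2 * of_int n powr (1 - r)"
        using True by (simp add: powr_diff powr_minus field_simps power2_eq_square)
      also have "\<dots> \<le> 1 + 8 * \<tau>\<^sup>2 * real N powr (1 - r)"
        using n True r by (intro add_mono mult_left_mono powr_mono2) auto
      finally have "(v n - u n) * (1 + 4 * \<tau> * of_int n) * (norm (a n))\<^sup>2 \<le> (1 + 8 * \<tau>\<^sup>2 * real N powr (1 - r)) * (norm (a n))\<^sup>2"
        by (rule mult_right_mono) auto
      then show ?thesis
        using True v1[OF True] by (simp add: W_def mult_ac)
    qed (auto simp: W_def)
  qed
  have F1_int: "(\<lambda>x. (norm (F1 x))\<^sup>2) integrable_on {0..1}"
      "integral {0..1} (\<lambda>x. (norm (F1 x))\<^sup>2) \<le> (1 + 2 * harm (2 * N) / \<tau>) * ?S"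
  proof -
    have lower: "\<tau> \<le> 1 * (1 - 2 * real k * of_int n * x ^ (k - 1))" if "x \<in> {0..u n}" for n x
    proof (cases "n \<ge> 1")
      case True
      have "x ^ (k - 1) \<le> (u n) ^ (k - 1)"
        using that by (intro power_mono) auto
      then show ?thesis
        unfolding upow[OF True] using kn[OF True] by (simp add: pos_le_divide_eq mult.commute)
    next
      case False
      then have "2 * real k * of_int n * x ^ (k - 1) \<le> 0"
        using that by (intro mult_nonpos_nonneg mult_nonneg_nonpos) auto
      moreover have "\<tau> \<le> 1 * (1 - t)" if "t \<le> 0" for t
        using that assms by simp
      ultimately show ?thesis
        by blast
    qed
    show "(\<lambda>x. (norm (F1 x))\<^sup>2) integrable_on {0..1}"
      unfolding F1_def using assms u1 lower by (intro cutoff_l2_bound(1)[where \<sigma> = 1 and \<tau> = \<tau>]) auto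
    show "integral {0..1} (\<lambda>x. (norm (F1 x))\<^sup>2) \<le> (1 + 2 * harm (2 * N) / \<tau>) * ?S"
      unfolding F1_def using assms u1 lower by (intro cutoff_l2_bound(2)[where \<sigma> = 1 and \<tau> = \<tau>]) auto
  qed
  have F2_int: "(\<lambda>x. (norm (F2 x))\<^sup>2) integrable_on {0..1}"
      "integral {0..1} (\<lambda>x. (norm (F2 x))\<^sup>2) \<le> (1 + 2 * harm (2 * N) / \<tau>) * ?S"
  proof -
    have lower: "\<tau> \<le> - 1 * (1 - 2 * real k * of_int n * x ^ (k - 1))" if "x \<in> {v n..1}" for n x
    proof (cases "n \<ge> 1")
      case True
      have "(v n) ^ (k - 1) \<le> x ^ (k - 1)"
        using that v0[of n] by (intro power_mono) auto
      then show ?thesis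
        unfolding vpow[OF True] using kn[OF True] by (simp add: pos_divide_le_eq mult.commute)
    next
      case False
      then show ?thesis
        using that by (auto simp: v_def)
    qed
    show "(\<lambda>x. (norm (F2 x))\<^sup>2) integrable_on {0..1}"
      unfolding F2_def using assms v0 lower by (intro cutoff_l2_bound(1)[where \<sigma> = "- 1" and \<tau> = \<tau>]) auto
    show "integral {0..1} (\<lambda>x. (norm (F2 x))\<^sup>2) \<le> (1 + 2 * harm (2 * N) / \<tau>) * ?S"
      unfolding F2_def using assms v0 lower by (intro cutoff_l2_bound(2)[where \<sigma> = "- 1" and \<tau> = \<tau>]) auto
  qed
  have "integral {0..1} (\<lambda>x. (norm (exp_sum k N a x))\<^sup>2)
      \<le> integral {0..1} (\<lambda>x. 3 * ((norm (F1 x))\<^sup>2 + (norm (F2 x))\<^sup>2 + G x))"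
  proof (rule integral_le)
    show "(\<lambda>x. (norm (exp_sum k N a x))\<^sup>2) integrable_on {0..1}"
      unfolding exp_sum_osc by (intro integrable_continuous_interval continuous_intros)
    show "(\<lambda>x. 3 * ((norm (F1 x))\<^sup>2 + (norm (F2 x))\<^sup>2 + G x)) integrable_on {0..1}"
      using F1_int F2_int G_int by (intro integrable_on_mult_right integrable_add) auto
    show "(norm (exp_sum k N a x))\<^sup>2 \<le> 3 * ((norm (F1 x))\<^sup>2 + (norm (F2 x))\<^sup>2 + G x)" if "x \<in> {0..1}" for x
      using norm_add3_squared[of "F1 x" "F2 x" "F3 x"] F3[OF that] split[OF that] by simp
  qed
  also have "\<dots> = 3 * (integral {0..1} (\<lambda>x. (norm (F1 x))\<^sup>2) + integral {0..1} (\<lambda>x. (norm (F2 x))\<^sup>2) + integral {0..1} G)"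
    using F1_int F2_int G_int
    by (subst integral_mult_right, subst integral_add, (auto intro!: integrable_add)[2], subst integral_add) auto
  also have "\<dots> \<le> 3 * ((1 + 2 * harm (2 * N) / \<tau>) * ?S + (1 + 2 * harm (2 * N) / \<tau>) * ?S + (1 + 8 * \<tau>\<^sup>2 * real N powr (1 - r)) * ?S)"
    using F1_int F2_int G_le integral_unique[OF G_int] by (intro mult_left_mono add_mono) auto
  also have "\<dots> = 3 * (3 + 4 * harm (2 * N) / \<tau> + 8 * \<tau>\<^sup>2 * real N powr (1 - r)) * ?S"
    by (simp add: algebra_simps)
  finally show ?thesis
    by (simp only: r_def)
qed

section \<open>The bound for \<open>p = 4\<close>\<close>

text \<open>The square of a function of the form \<open>F = \<Sum> a\<^sub>n f\<^sub>n\<close> is the image of the tensor \<open>a \<otimes> a\<close> under an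
  operator whose \<open>T T\<^sup>*\<close> kernel is the square of the kernel \<open>\<Sum> f\<^sub>n(x) cnj (f\<^sub>n(y))\<close>; Schur's test bounds it on \<open>L\<^sup>2\<close>.\<close>

lemma l4_bound_by_kernel:
  fixes f :: "'i \<Rightarrow> real \<Rightarrow> complex" and a :: "'i \<Rightarrow> complex" and A :: "'i set" and p q M :: real
  defines "F \<equiv> \<lambda>x. \<Sum>n\<in>A. a n * f n x"
  assumes "finite A" "p \<le> q" and cont: "\<And>n. n \<in> A \<Longrightarrow> continuous_on UNIV (f n)"
    and M: "\<And>x. x \<in> {p..q} \<Longrightarrow> integral {p..q} (\<lambda>y. (norm (\<Sum>n\<in>A. f n x * cnj (f n y)))\<^sup>2) \<le> M"
  shows "integral {p..q} (\<lambda>x. norm (F x) ^ 4) \<le> M * (\<Sum>n\<in>A. (norm (a n))\<^sup>2)\<^sup>2"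
proof -
  note cf = continuous_on_compose2[OF cont _ subset_UNIV]
  have cF: "continuous_on S (\<lambda>z. F (g z))" if "continuous_on S g" for S :: "'b::topological_space set" and g
    unfolding F_def using that by (intro continuous_intros cf)
  define G where "G x y = (\<Sum>n\<in>A. f n x * cnj (f n y))" for x y
  have cG: "continuous_on S (\<lambda>z. G (g z) (h z))" if "continuous_on S g" "continuous_on S h"
    for S :: "'b::topological_space set" and g h
    unfolding G_def using that by (intro continuous_intros cf)
  have G_sym: "norm (G y x) = norm (G x y)" for x y
  proof -
    have "G y x = cnj (G x y)"
      by (simp add: G_def mult.commute)
    then show ?thesis
      by simp
  qed
  have G_sq: "(G x y)\<^sup>2 = (\<Sum>n\<in>A. \<Sum>m\<in>A. (f n x * f m x) * cnj (f n y * f m y))" for x y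
    by (simp add: G_def power2_eq_square sum_product mult_ac)
  have F_sq: "(F x)\<^sup>2 = (\<Sum>n\<in>A. \<Sum>m\<in>A. a n * a m * (f n x * f m x))" for x
    by (simp add: F_def power2_eq_square sum_product mult_ac)
  have norm4: "complex_of_real (norm (F x) ^ 4) = cnj ((F x)\<^sup>2) * (F x)\<^sup>2" for x
  proof -
    have "complex_of_real (norm (F x) ^ 4) = (complex_of_real ((norm (F x))\<^sup>2))\<^sup>2"
      by simp
    then show ?thesis
      unfolding complex_norm_square by (simp add: power_mult_distrib mult.commute)
  qed
  define J where "J = integral {p..q} (\<lambda>x. norm (F x) ^ 4)"
  have J0: "J \<ge> 0"
    unfolding J_def by (intro integral_nonneg integrable_continuous_interval continuous_intros cF) auto
  \<comment> \<open>\<open>J\<close> is the pairing of the tensor \<open>a n * a m\<close> with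
    \<open>c\<close>, and \<open>c\<close> is the transposed operator applied to
    \<open>cnj ((F x)\<^sup>2)\<close>. Cauchy-Schwarz separates the coefficients from
    \<open>S\<close>, the square norm of \<open>c\<close>, which depends on the kernel.\<close>
  define c where "c n m = integral {p..q} (\<lambda>x. cnj ((F x)\<^sup>2) * (f n x * f m x))" for n m
  define S where "S = (\<Sum>n\<in>A. \<Sum>m\<in>A. (norm (c n m))\<^sup>2)"
  have c_int: "(\<lambda>x. cnj ((F x)\<^sup>2) * (f n x * f m x)) integrable_on {p..q}" if "n \<in> A" "m \<in> A" for n m
    using that by (intro integrable_continuous_interval continuous_intros cF cf)
  have c_has: "((\<lambda>x. cnj ((F x)\<^sup>2) * (f n x * f m x)) has_integral c n m) {p..q}"
    if "n \<in> A" "m \<in> A" for n m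
    using c_int[OF that] unfolding c_def by (rule integrable_integral)
  have "complex_of_real J = integral {p..q} (\<lambda>x. complex_of_real (norm (F x) ^ 4))"
    unfolding J_def
    by (intro integral_unique[symmetric] has_integral_of_real integrable_integral
        integrable_continuous_interval continuous_intros cF)
  also have "\<dots> = integral {p..q} (\<lambda>x. \<Sum>n\<in>A. \<Sum>m\<in>A. a n * a m * (cnj ((F x)\<^sup>2) * (f n x * f m x)))"
    unfolding norm4 by (subst (2) F_sq) (simp add: sum_distrib_left mult_ac)
  also have "\<dots> = (\<Sum>n\<in>A. \<Sum>m\<in>A. a n * a m * c n m)"
    using \<open>finite A\<close> by (intro integral_unique has_integral_sum has_integral_mult_right c_has)
  finally have J_eq: "complex_of_real J = (\<Sum>n\<in>A. \<Sum>m\<in>A. a n * a m * c n m)" .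
  have J_sq: "J\<^sup>2 \<le> (\<Sum>n\<in>A. (norm (a n))\<^sup>2)\<^sup>2 * S"
  proof -
    have "J = norm (\<Sum>n\<in>A. \<Sum>m\<in>A. a n * a m * c n m)"
      using J0 by (simp flip: J_eq)
    also have "\<dots> \<le> (\<Sum>n\<in>A. \<Sum>m\<in>A. norm (a n) * norm (a m) * norm (c n m))"
      by (intro sum_norm_le) (simp add: norm_mult)
    also have "\<dots> = (\<Sum>z\<in>A \<times> A. norm (a (fst z)) * norm (a (snd z)) * norm (c (fst z) (snd z)))"
      by (simp add: sum.cartesian_product case_prod_beta)
    finally have "J\<^sup>2 \<le> (\<Sum>z\<in>A \<times> A. norm (a (fst z)) * norm (a (snd z)) * norm (c (fst z) (snd z)))\<^sup>2"
      using J0 by (intro power_mono)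
    also have "\<dots> \<le> (\<Sum>z\<in>A \<times> A. (norm (a (fst z)) * norm (a (snd z)))\<^sup>2) * (\<Sum>z\<in>A \<times> A. (norm (c (fst z) (snd z)))\<^sup>2)"
      by (rule Cauchy_Schwarz_ineq_sum)
    also have "(\<Sum>z\<in>A \<times> A. (norm (c (fst z) (snd z)))\<^sup>2) = S"
      by (simp add: S_def sum.cartesian_product case_prod_beta)
    also have "(\<Sum>z\<in>A \<times> A. (norm (a (fst z)) * norm (a (snd z)))\<^sup>2) = (\<Sum>n\<in>A. (norm (a n))\<^sup>2)\<^sup>2"
      by (simp add: power2_eq_square[of "\<Sum>n\<in>A. (norm (a n))\<^sup>2"] sum_product sum.cartesian_product case_prod_beta power_mult_distrib)
    finally show ?thesis .
  qed
  \<comment> \<open>\<open>I\<close> is the operator with kernel \<open>G^2\<close> applied to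
    \<open>F^2\<close>, and \<open>S\<close> is its pairing with \<open>cnj (F^2)\<close>. Bounding
    the product \<open>\<bar>F x\<bar>^2 \<bar>F y\<bar>^2\<close> by the mean of the fourth powers
    gives two halves: one leads to the row integral \<open>M'\<close> directly, the other is
    \<open>H\<close>.\<close>
  define I where "I x = integral {p..q} (\<lambda>y. (F y)\<^sup>2 * (G x y)\<^sup>2)" for x
  define H where "H x = integral {p..q} (\<lambda>y. (norm (F y) ^ 4) * (norm (G x y))\<^sup>2)" for x
  define M' where "M' x = integral {p..q} (\<lambda>y. (norm (G x y))\<^sup>2)" for x
  have cH: "continuous_on {p..q} H"
    unfolding H_def cbox_interval[symmetric]
    by (intro integral_continuous_on_param) (auto simp: case_prod_beta intro!: continuous_intros cF cG)
  have cI: "continuous_on {p..q} I"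
    unfolding I_def cbox_interval[symmetric]
    by (intro integral_continuous_on_param) (auto simp: case_prod_beta intro!: continuous_intros cF cG)
  have M'_le: "M' x \<le> M" if "x \<in> {p..q}" for x
    unfolding M'_def G_def using M[OF that] .
  have "0 \<le> M' p"
    unfolding M'_def by (intro integral_nonneg integrable_continuous_interval continuous_intros cG) auto
  then have M0: "0 \<le> M"
    using M'_le[of p] \<open>p \<le> q\<close> by simp
  \<comment> \<open>Swapping the integrals turns \<open>H\<close> into the first half again, because
    \<open>\<bar>G x y\<bar>\<close> is symmetric.\<close>
  have "integral {p..q} H = integral {p..q} (\<lambda>y. integral {p..q} (\<lambda>x. norm (F y) ^ 4 * (norm (G x y))\<^sup>2))"
    unfolding H_def cbox_interval[symmetric]
    by (intro integral_swap_continuous) (auto simp: case_prod_beta intro!: continuous_intros cF cG)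
  also have "\<dots> = integral {p..q} (\<lambda>y. norm (F y) ^ 4 * M' y)"
    unfolding M'_def by (simp add: G_sym[of _ _])
  also have "\<dots> \<le> integral {p..q} (\<lambda>y. norm (F y) ^ 4 * M)"
  proof (rule integral_le)
    have "continuous_on {p..q} M'"
      unfolding M'_def cbox_interval[symmetric]
      by (intro integral_continuous_on_param) (auto simp: case_prod_beta intro!: continuous_intros cG)
    then show "(\<lambda>y. norm (F y) ^ 4 * M' y) integrable_on {p..q}"
      by (intro integrable_continuous_interval continuous_intros cF)
  qed (auto intro!: integrable_continuous_interval continuous_intros cF mult_left_mono M'_le)
  also have "\<dots> = M * J"
    by (simp add: J_def mult.commute)
  finally have H_le: "integral {p..q} H \<le> M * J" .
  have S_le: "S \<le> M * J"
  proof -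
    have cnj_c: "cnj (c n m) = integral {p..q} (\<lambda>y. (F y)\<^sup>2 * cnj (f n y * f m y))"
      if "n \<in> A" "m \<in> A" for n m
      using integral_linear[OF c_int[OF that] bounded_linear_cnj] unfolding c_def
      by (simp only: o_def complex_cnj_mult complex_cnj_power complex_cnj_cnj)
    have I_eq: "I x = (\<Sum>n\<in>A. \<Sum>m\<in>A. cnj (c n m) * (f n x * f m x))" for x
    proof -
      have "I x = integral {p..q} (\<lambda>y. \<Sum>n\<in>A. \<Sum>m\<in>A. ((F y)\<^sup>2 * cnj (f n y * f m y)) * (f n x * f m x))"
        unfolding I_def G_sq by (simp add: sum_distrib_left mult_ac)
      also have "\<dots> = (\<Sum>n\<in>A. \<Sum>m\<in>A. integral {p..q} (\<lambda>y. (F y)\<^sup>2 * cnj (f n y * f m y)) * (f n x * f m x))"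
        using \<open>finite A\<close>
        by (intro integral_unique has_integral_sum has_integral_mult_left integrable_integral)
           (auto intro!: integrable_continuous_interval continuous_intros cF cf)
      also have "\<dots> = (\<Sum>n\<in>A. \<Sum>m\<in>A. cnj (c n m) * (f n x * f m x))"
        by (intro sum.cong refl arg_cong2[where f = "(*)"] cnj_c[symmetric])
      finally show ?thesis .
    qed
    have "complex_of_real S = (\<Sum>n\<in>A. \<Sum>m\<in>A. cnj (c n m) * c n m)"
      unfolding S_def of_real_sum complex_norm_square by (simp only: mult.commute)
    also have "\<dots> = integral {p..q} (\<lambda>x. \<Sum>n\<in>A. \<Sum>m\<in>A. cnj (c n m) * (cnj ((F x)\<^sup>2) * (f n x * f m x)))"
      using \<open>finite A\<close>
      by (intro integral_unique[symmetric] has_integral_sum has_integral_mult_right c_has)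
    also have "\<dots> = integral {p..q} (\<lambda>x. cnj ((F x)\<^sup>2) * I x)"
      unfolding I_eq by (simp add: sum_distrib_left mult_ac)
    finally have "norm (complex_of_real S) = norm (integral {p..q} (\<lambda>x. cnj ((F x)\<^sup>2) * I x))"
      by (rule arg_cong)
    moreover have "S \<ge> 0"
      unfolding S_def by (intro sum_nonneg) auto
    ultimately have "S = norm (integral {p..q} (\<lambda>x. cnj ((F x)\<^sup>2) * I x))"
      by simp
    also have "\<dots> \<le> integral {p..q} (\<lambda>x. (M * norm (F x) ^ 4 + H x) / 2)"
    proof (rule integral_norm_bound_integral)
      fix x assume x: "x \<in> {p..q}"
      have "norm (cnj ((F x)\<^sup>2) * I x) = norm (integral {p..q} (\<lambda>y. cnj ((F x)\<^sup>2) * ((F y)\<^sup>2 * (G x y)\<^sup>2)))"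
        by (simp add: I_def)
      also have "\<dots> \<le> integral {p..q} (\<lambda>y. (norm (F x) ^ 4 * (norm (G x y))\<^sup>2 + norm (F y) ^ 4 * (norm (G x y))\<^sup>2) / 2)"
      proof (rule integral_norm_bound_integral)
        fix y
        have "2 * ((norm (F x))\<^sup>2 * (norm (F y))\<^sup>2) \<le> norm (F x) ^ 4 + norm (F y) ^ 4"
          using sum_squares_bound[of "(norm (F x))\<^sup>2" "(norm (F y))\<^sup>2"] by (simp add: mult_ac)
        then have "((norm (F x))\<^sup>2 * (norm (F y))\<^sup>2) * (norm (G x y))\<^sup>2
            \<le> ((norm (F x) ^ 4 + norm (F y) ^ 4) / 2) * (norm (G x y))\<^sup>2"
          by (intro mult_right_mono) auto
        then show "norm (cnj ((F x)\<^sup>2) * ((F y)\<^sup>2 * (G x y)\<^sup>2))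
            \<le> (norm (F x) ^ 4 * (norm (G x y))\<^sup>2 + norm (F y) ^ 4 * (norm (G x y))\<^sup>2) / 2"
          by (simp add: norm_mult norm_power algebra_simps add_divide_distrib)
      qed (auto intro!: integrable_continuous_interval continuous_intros cF cG)
      also have "\<dots> = (norm (F x) ^ 4 * M' x + H x) / 2"
        unfolding M'_def H_def
        by (intro integral_unique has_integral_divide has_integral_add has_integral_mult_right integrable_integral)
           (auto intro!: integrable_continuous_interval continuous_intros cF cG)
      also have "\<dots> \<le> (M * norm (F x) ^ 4 + H x) / 2"
        using M'_le[OF x] by (simp add: mult.commute mult_right_mono)
      finally show "norm (cnj ((F x)\<^sup>2) * I x) \<le> (M * norm (F x) ^ 4 + H x) / 2" .
    qed (auto intro!: integrable_continuous_interval continuous_intros cF cH cI)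
    also have "\<dots> = (M * J + integral {p..q} H) / 2"
      unfolding J_def
      by (intro integral_unique has_integral_divide has_integral_add has_integral_mult_right integrable_integral)
         (auto intro!: integrable_continuous_interval continuous_intros cF cH)
    also have "\<dots> \<le> (M * J + M * J) / 2"
      using H_le by (intro divide_right_mono add_left_mono) auto
    also have "\<dots> = M * J"
      by simp
    finally show ?thesis .
  qed
  \<comment> \<open>\<open>S\<close> is again controlled by \<open>J\<close>, so the inequality is
    quadratic in \<open>J\<close> on the left and linear on the right; one factor \<open>J\<close>
    cancels.\<close>
  have "J * J \<le> (M * (\<Sum>n\<in>A. (norm (a n))\<^sup>2)\<^sup>2) * J"
    using J_sq mult_left_mono[OF S_le, of "(\<Sum>n\<in>A. (norm (a n))\<^sup>2)\<^sup>2"] by (simp add: power2_eq_square mult_ac)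
  moreover have "0 \<le> M * (\<Sum>n\<in>A. (norm (a n))\<^sup>2)\<^sup>2"
    using M0 by simp
  ultimately show ?thesis
    using J0 unfolding J_def[symmetric] by (cases "J = 0") auto
qed

text \<open>Up to a constant factor this is
  \<open>min W (1 / \<bar>sin (pi * \<theta>)\<bar>)\<close>, the usual bound for a geometric sum of
  at most \<open>W\<close> terms, in a form that is continuous and free of case
  distinctions.\<close>

definition dirichlet_bound :: "real \<Rightarrow> real \<Rightarrow> real" where
  "dirichlet_bound W \<theta> = 2 / (\<bar>sin (pi * \<theta>)\<bar> + 1 / W)"

lemma dirichlet_bound_nonneg: "W > 0 \<Longrightarrow> dirichlet_bound W \<theta> \<ge> 0"
  by (simp add: dirichlet_bound_def)

lemma dirichlet_bound_minus: "dirichlet_bound W (- \<theta>) = dirichlet_bound W \<theta>"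
  by (simp add: dirichlet_bound_def)

lemma continuous_on_dirichlet_bound [continuous_intros]:
  fixes g :: "real \<Rightarrow> real"
  assumes "W > 0" "continuous_on S g"
  shows "continuous_on S (\<lambda>x. dirichlet_bound W (g x))"
proof -
  have nz: "\<bar>sin (pi * \<theta>)\<bar> + 1 / W \<noteq> 0" for \<theta>
    using add_nonneg_pos[of "\<bar>sin (pi * \<theta>)\<bar>" "1 / W"] assms(1) by simp
  show ?thesis
    unfolding dirichlet_bound_def
    by (intro continuous_on_divide continuous_on_add continuous_on_const continuous_on_rabs
        continuous_on_sin continuous_on_mult assms(2) ballI nz) (use assms(1) in auto)
qed

lemma norm_ch_minus_1: "norm (ch \<theta> - 1) = 2 * \<bar>sin (pi * \<theta>)\<bar>"
proof -
  have "ch \<theta> - 1 = cis (pi * \<theta>) * (cis (pi * \<theta>) - cis (- (pi * \<theta>)))"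
    by (simp add: ch_def right_diff_distrib cis_mult mult.assoc)
  also have "cis (pi * \<theta>) - cis (- (pi * \<theta>)) = 2 * \<i> * of_real (sin (pi * \<theta>))"
    by (simp add: complex_eq_iff)
  finally show ?thesis
    by (simp add: norm_mult)
qed

text \<open>Telescoping bounds the norm times \<open>\<bar>sin (pi * \<theta>)\<bar>\<close> by 1,
  the trivial estimate bounds the norm over \<open>W\<close> by 1, and adding the two gives the
  numerator 2. \<open>W\<close> may exceed the number of terms, so one value serves for all shifts
  in Weyl differencing.\<close>

lemma norm_geometric_sum_le:
  fixes a b :: int
  assumes "W > 0" "real (card {a..b}) \<le> W"
  shows "norm (\<Sum>m\<in>{a..b}. ch (of_int m * \<theta>)) \<le> dirichlet_bound W \<theta>"
proof -
  let ?s = "\<Sum>m\<in>{a..b}. ch (of_int m * \<theta>)"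
  have "norm ?s * norm (ch \<theta> - 1) \<le> 2"
  proof (cases "a \<le> b")
    case True
    define n where "n = nat (b + 1 - a)"
    define g where "g j = ch (of_int (a + int j) * \<theta>)" for j
    have "?s = (\<Sum>j<n. g j)"
      unfolding g_def
      by (intro sum.reindex_bij_witness[of _ "\<lambda>j. a + int j" "\<lambda>m. nat (m - a)"]) (auto simp: n_def)
    then have "?s * (ch \<theta> - 1) = (\<Sum>j<n. g j) * (ch \<theta> - 1)"
      by (rule arg_cong)
    also have "\<dots> = (\<Sum>j<n. g (Suc j) - g j)"
      unfolding sum_distrib_right by (intro sum.cong refl) (simp add: g_def algebra_simps ch_add)
    also have "\<dots> = g n - g 0"
      by (rule sum_lessThan_telescope)
    finally have "norm ?s * norm (ch \<theta> - 1) = norm (g n - g 0)"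
      by (simp flip: norm_mult)
    also have "\<dots> \<le> norm (g n) + norm (g 0)"
      by (rule norm_triangle_ineq4)
    finally show ?thesis
      by (simp add: g_def)
  qed simp
  then have 1: "norm ?s * \<bar>sin (pi * \<theta>)\<bar> \<le> 1"
    by (simp add: norm_ch_minus_1)
  have "norm ?s \<le> real (card {a..b})"
    by (rule order_trans[OF norm_sum]) simp
  then have 2: "norm ?s / W \<le> 1"
    using assms by simp
  have "\<bar>sin (pi * \<theta>)\<bar> + 1 / W > 0"
    using assms(1) by (simp add: add_nonneg_pos)
  then show ?thesis
    using 1 2 by (simp add: dirichlet_bound_def pos_le_divide_eq distrib_left)
qed

text \<open>After setting \<open>n = m + h\<close> the terms quadratic in \<open>m\<close> cancel,
  and for fixed \<open>h\<close> the sum over \<open>m\<close> is geometric with frequency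
  \<open>- 2 * h * t\<close>. The linear coefficient \<open>u\<close> survives only in a unimodular
  factor, so the bound is uniform in it.\<close>

lemma weyl_differencing:
  fixes u t :: real
  shows "(norm (\<Sum>n\<in>{- int N..int N}. ch (of_int n * u - (of_int n)\<^sup>2 * t)))\<^sup>2
      \<le> (\<Sum>h\<in>{- 2 * int N..2 * int N}. dirichlet_bound (2 * real N + 1) (2 * of_int h * t))"
proof -
  let ?A = "{- int N..int N}" and ?B = "{- 2 * int N..2 * int N}"
  define I where "I h = {max (- int N) (- int N - h)..min (int N) (int N - h)}" for h
  define g where "g n = ch (of_int n * u - (of_int n)\<^sup>2 * t)" for n :: int
  have g: "g (m + h) * cnj (g m) = ch (of_int h * u - (of_int h)\<^sup>2 * t) * ch (of_int m * - (2 * of_int h * t))" for m h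
    unfolding g_def ch_diff[symmetric] ch_add[symmetric]
    by (rule arg_cong[of _ _ ch]) (simp add: algebra_simps power2_eq_square)
  have "complex_of_real ((norm (sum g ?A))\<^sup>2) = (\<Sum>n\<in>?A. \<Sum>m\<in>?A. g n * cnj (g m))"
    unfolding complex_norm_square cnj_sum by (rule sum_product)
  also have "\<dots> = (\<Sum>(n, m)\<in>?A \<times> ?A. g n * cnj (g m))"
    by (rule sum.cartesian_product)
  also have "\<dots> = (\<Sum>(h, m)\<in>(SIGMA h:?B. I h). g (m + h) * cnj (g m))"
    by (rule sum.reindex_bij_witness[of _ "\<lambda>(h, m). (m + h, m)" "\<lambda>(n, m). (n - m, m)"]) (auto simp: I_def)
  also have "\<dots> = (\<Sum>h\<in>?B. \<Sum>m\<in>I h. g (m + h) * cnj (g m))"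
    by (subst sum.Sigma) (auto simp: I_def)
  also have "\<dots> = (\<Sum>h\<in>?B. ch (of_int h * u - (of_int h)\<^sup>2 * t) * (\<Sum>m\<in>I h. ch (of_int m * - (2 * of_int h * t))))"
    unfolding g sum_distrib_left ..
  finally have "norm (complex_of_real ((norm (sum g ?A))\<^sup>2))
      = norm (\<Sum>h\<in>?B. ch (of_int h * u - (of_int h)\<^sup>2 * t) * (\<Sum>m\<in>I h. ch (of_int m * - (2 * of_int h * t))))"
    by (rule arg_cong)
  then have "(norm (sum g ?A))\<^sup>2
      = norm (\<Sum>h\<in>?B. ch (of_int h * u - (of_int h)\<^sup>2 * t) * (\<Sum>m\<in>I h. ch (of_int m * - (2 * of_int h * t))))"
    by (simp only: norm_of_real abs_power2)
  also have "\<dots> \<le> (\<Sum>h\<in>?B. dirichlet_bound (2 * real N + 1) (2 * of_int h * t))"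
  proof (rule sum_norm_le)
    fix h
    have "card (I h) \<le> card ?A"
      by (intro card_mono) (auto simp: I_def)
    then have "real (card (I h)) \<le> 2 * real N + 1"
      by simp
    then have "norm (\<Sum>m\<in>I h. ch (of_int m * - (2 * of_int h * t))) \<le> dirichlet_bound (2 * real N + 1) (- (2 * of_int h * t))"
      unfolding I_def by (intro norm_geometric_sum_le) auto
    then show "norm (ch (of_int h * u - (of_int h)\<^sup>2 * t) * (\<Sum>m\<in>I h. ch (of_int m * - (2 * of_int h * t))))
        \<le> dirichlet_bound (2 * real N + 1) (2 * of_int h * t)"
      by (simp only: norm_mult norm_ch mult_1 dirichlet_bound_minus)
  qed
  finally show ?thesis
    by (simp only: g_def[abs_def])
qed

text \<open>For \<open>x = pi * \<theta> \<le> 2\<close>, Taylor's formula gives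
  \<open>sin x \<ge> x - x^3 / 6 \<ge> x / 3\<close>, and \<open>pi > 3\<close>.\<close>

lemma sin_pi_ge_self:
  assumes "0 \<le> \<theta>" "\<theta> \<le> 1 / 2"
  shows "sin (pi * \<theta>) \<ge> \<theta>"
proof -
  define x where "x = pi * \<theta>"
  have x: "0 \<le> x" "x \<le> 2"
    using assms pi_less_4 mult_mono[of pi 4 \<theta> "1 / 2"] by (auto simp: x_def)
  have "\<bar>sin x - (\<Sum>m<3. sin_coeff m * x ^ m)\<bar> \<le> inverse (fact 3) * \<bar>x\<bar> ^ 3"
    by (rule Maclaurin_sin_bound)
  then have "\<bar>sin x - x\<bar> \<le> x ^ 3 / 6"
    using x by (simp add: numeral_3_eq_3 sin_coeff_def fact_numeral)
  moreover have "x ^ 3 \<le> 4 * x"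
    using x mult_mono[of "x * x" "4" x x] mult_mono[of x 2 x 2] by (simp add: power3_eq_cube)
  moreover have "x \<ge> 3 * \<theta>"
    using pi_gt3 assms by (simp add: x_def mult_right_mono)
  ultimately show ?thesis
    unfolding x_def[symmetric] by linarith
qed

text \<open>On half a period the majorant is dominated by \<open>2 / (\<theta> + 1 / W)\<close>, a
  singularity truncated at scale \<open>1 / W\<close> with logarithmic integral. The reflection of
  \<open>\<theta>\<close> to \<open>1 - \<theta>\<close> supplies the other half.\<close>

lemma integral_dirichlet_bound_period:
  assumes "W > 0"
  shows "integral {0..1} (dirichlet_bound W) \<le> 4 * ln (1 + W)"
proof -
  have cont: "continuous_on S (dirichlet_bound W)" for S
    using continuous_on_dirichlet_bound[OF assms continuous_on_id] by simp
  have sin_sym: "sin (pi * (1 - \<theta>)) = sin (pi * \<theta>)" for \<theta>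
    by (simp add: right_diff_distrib)
  have half: "integral {0..1 / 2} (dirichlet_bound W) \<le> 2 * ln (1 + W)"
  proof -
    have F: "((\<lambda>\<theta>. 2 / (\<theta> + 1 / W)) has_integral (2 * ln (1 / 2 + 1 / W) - 2 * ln (0 + 1 / W))) {0..1 / 2}"
      using assms
      by (intro fundamental_theorem_of_calculus)
         (auto intro!: derivative_eq_intros add_nonneg_pos simp flip: has_real_derivative_iff_has_vector_derivative)
    have "integral {0..1 / 2} (dirichlet_bound W) \<le> integral {0..1 / 2} (\<lambda>\<theta>. 2 / (\<theta> + 1 / W))"
    proof (rule integral_le)
      fix \<theta> :: real assume \<theta>: "\<theta> \<in> {0..1 / 2}"
      have "\<theta> \<le> \<bar>sin (pi * \<theta>)\<bar>"
        using sin_pi_ge_self[of \<theta>] \<theta> by simp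
      then show "dirichlet_bound W \<theta> \<le> 2 / (\<theta> + 1 / W)"
        unfolding dirichlet_bound_def using \<theta> assms by (intro divide_left_mono mult_pos_pos add_nonneg_pos) auto
    qed (use F cont in \<open>auto intro: integrable_continuous_interval\<close>)
    also have "\<dots> = 2 * (ln (1 / 2 + 1 / W) - ln (1 / W))"
      using integral_unique[OF F] by simp
    also have "ln (1 / 2 + 1 / W) - ln (1 / W) = ln (1 + W / 2)"
    proof -
      have "1 / 2 + 1 / W = (1 + W / 2) * (1 / W)"
        using assms by (simp add: field_simps)
      then have "ln (1 / 2 + 1 / W) = ln (1 + W / 2) + ln (1 / W)"
        using assms by (simp only:) (subst ln_mult, auto)
      then show ?thesis
        by simp
    qed
    also have "\<dots> \<le> ln (1 + W)"
      using assms by simp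
    finally show ?thesis
      by simp
  qed
  have "integral {1 / 2..1} (dirichlet_bound W) = integral {1 / 2..1} (\<lambda>\<theta>. dirichlet_bound W (- (\<theta> - 1)))"
    by (intro integral_cong) (use sin_sym in \<open>simp add: dirichlet_bound_def\<close>)
  also have "\<dots> = integral {- (1 / 2)..0} (\<lambda>\<theta>. dirichlet_bound W (- \<theta>))"
    using integral_shift_real_ivl[of "1 / 2" "- 1" 1 "\<lambda>\<theta>. dirichlet_bound W (- \<theta>)"]
    using integral_shift_real_ivl[of "- (1 / 2)" "- 1" 0 "\<lambda>\<theta>. dirichlet_bound W (- \<theta>)"] by simp
  also have "\<dots> = integral {0..1 / 2} (dirichlet_bound W)"
    using Henstock_Kurzweil_Integration.integral_reflect_real[of 0 "- (1 / 2)" "\<lambda>\<theta>. dirichlet_bound W (- \<theta>)"] by simp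
  finally have "integral {0..1} (dirichlet_bound W) = 2 * integral {0..1 / 2} (dirichlet_bound W)"
    using Henstock_Kurzweil_Integration.integral_combine[of 0 "1 / 2" 1 "dirichlet_bound W"] cont
    by (simp add: integrable_continuous_interval)
  then show ?thesis
    using half by simp
qed

lemma integral_dirichlet_bound_le:
  assumes "W > 0" "a \<le> b"
  shows "integral {a..b} (dirichlet_bound W) \<le> (b - a + 2) * (4 * ln (1 + W))"
proof -
  have cont: "continuous_on S (dirichlet_bound W)" for S
    using continuous_on_dirichlet_bound[OF assms(1) continuous_on_id] by simp
  have unit: "integral {of_int j..of_int j + 1} (dirichlet_bound W) = integral {0..1} (dirichlet_bound W)" for j
  proof -
    have "sin (pi * of_int j) = 0"
      by (auto simp: sin_zero_iff_int2)
    then have "dirichlet_bound W (\<theta> + of_int j) = dirichlet_bound W \<theta>" for \<theta>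
      using sin_zero_abs_cos_one[of "pi * of_int j"] by (simp add: dirichlet_bound_def distrib_left sin_add abs_mult)
    then show ?thesis
      using integral_shift_real_ivl[of "of_int j" "of_int j" "of_int j + 1" "dirichlet_bound W"] by simp
  qed
  have steps: "integral {of_int j..of_int j + real n} (dirichlet_bound W) = real n * integral {0..1} (dirichlet_bound W)" for j n
  proof (induction n)
    case (Suc n)
    have "integral {of_int j..of_int j + real (Suc n)} (dirichlet_bound W) =
        integral {of_int j..of_int j + real n} (dirichlet_bound W) +
        integral {of_int j + real n..of_int j + real (Suc n)} (dirichlet_bound W)"
      by (intro Henstock_Kurzweil_Integration.integral_combine[symmetric] integrable_continuous_interval cont) auto
    then show ?case
      using unit[of "j + int n"] Suc by (simp add: algebra_simps)
  qed simp
  \<comment> \<open>Rounding both endpoints outwards to integers adds less than one period on each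
    side; this is the \<open>+ 2\<close> in the bound.\<close>
  define n where "n = nat (\<lceil>b\<rceil> - \<lfloor>a\<rfloor>)"
  have n: "real n = of_int (\<lceil>b\<rceil> - \<lfloor>a\<rfloor>)"
    using assms(2) unfolding n_def by (simp add: floor_le_ceiling order_trans[OF floor_mono])
  have sub: "{a..b} \<subseteq> {of_int \<lfloor>a\<rfloor>..of_int \<lfloor>a\<rfloor> + real n}"
    using of_int_floor_le[of a] le_of_int_ceiling[of b] unfolding n atLeastatMost_subset_iff of_int_diff by linarith
  have "real n \<le> b - a + 2"
    unfolding n of_int_diff by linarith
  have "integral {a..b} (dirichlet_bound W) \<le> integral {of_int \<lfloor>a\<rfloor>..of_int \<lfloor>a\<rfloor> + real n} (dirichlet_bound W)"
    by (intro integral_subset_le integrable_continuous_interval cont sub ballI dirichlet_bound_nonneg assms(1))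
  also have "\<dots> = real n * integral {0..1} (dirichlet_bound W)"
    by (rule steps)
  also have "\<dots> \<le> (b - a + 2) * (4 * ln (1 + W))"
    using \<open>real n \<le> b - a + 2\<close> assms(2) integral_dirichlet_bound_period[OF assms(1)]
    by (intro mult_mono integral_nonneg integrable_continuous_interval cont dirichlet_bound_nonneg assms(1)) auto
  finally show ?thesis .
qed

lemma harm_le_ln: "n \<ge> 1 \<Longrightarrow> harm n \<le> 1 + ln (real n)"
  using euler_mascheroni_sequence_decreasing[of 1 n] by (simp add: harm_expand)

text \<open>Change of variables to the argument of the Dirichlet majorant, whose speed on
  \<open>{Y..2 * Y}\<close> is at least of order \<open>\<bar>h\<bar> * Y^(k-1)\<close>. The length
  swept over, divided by the speed, gives the term in \<open>Y\<close>; the two extra periods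
  divided by the speed give the other term. The point \<open>x\<close> only translates the argument,
  whence the uniformity in \<open>x\<close>.\<close>

lemma integral_dirichlet_bound_phase:
  fixes x Y :: real
  assumes "k \<ge> 2" "W > 0" "Y > 0" "h \<noteq> 0"
  shows "integral {Y..2 * Y} (\<lambda>y. dirichlet_bound W (2 * of_int h * (x ^ k - y ^ k)))
      \<le> (2 ^ k * Y + 1 / (\<bar>of_int h\<bar> * Y ^ (k - 1))) * (4 * ln (1 + W))"
proof -
  let ?D = "dirichlet_bound W"
  \<comment> \<open>\<open>dirichlet_bound\<close> is even, so \<open>h\<close> may be replaced by
    its absolute value and the argument arranged to increase with \<open>y\<close>.\<close>
  define c where "c = 2 * \<bar>real_of_int h\<bar>"
  define g where "g y = c * (y ^ k - x ^ k)" for y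
  define g' where "g' y = c * (real k * y ^ (k - 1))" for y
  have c: "c > 0"
    using assms by (simp add: c_def)
  have D: "?D (2 * of_int h * (x ^ k - y ^ k)) = ?D (g y)" for y
  proof (cases "h > 0")
    case True
    then have "g y = - (2 * of_int h * (x ^ k - y ^ k))"
      by (simp add: g_def c_def algebra_simps)
    then show ?thesis
      by (simp only: dirichlet_bound_minus)
  next
    case False
    then have "g y = 2 * of_int h * (x ^ k - y ^ k)"
      by (simp add: g_def c_def algebra_simps)
    then show ?thesis
      by simp
  qed
  have cont: "continuous_on S (\<lambda>y. ?D (f y))" if "continuous_on S f" for S and f :: "real \<Rightarrow> real"
    using continuous_on_dirichlet_bound assms that by blast
  have g_mono: "g y \<le> g z" if "0 \<le> y" "y \<le> z" for y z
    using that c unfolding g_def by (intro mult_left_mono diff_right_mono power_mono) auto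
  have subst: "((\<lambda>y. g' y *\<^sub>R ?D (g y)) has_integral (integral {g Y..g (2 * Y)} ?D)) {Y..2 * Y}"
  proof (rule has_integral_substitution)
    show "g ` {Y..2 * Y} \<subseteq> {g Y..g (2 * Y)}"
      using g_mono \<open>Y > 0\<close> by auto
    show "continuous_on {g Y..g (2 * Y)} ?D"
      using cont[OF continuous_on_id] by simp
    show "(g has_real_derivative g' y) (at y within {Y..2 * Y})" for y
      unfolding g_def g'_def by (auto intro!: derivative_eq_intros)
  qed (use g_mono \<open>Y > 0\<close> in auto)
  define q where "q = c * (real k * Y ^ (k - 1))"
  have q: "q > 0"
    using c assms by (simp add: q_def)
  have "q * integral {Y..2 * Y} (\<lambda>y. ?D (g y)) = integral {Y..2 * Y} (\<lambda>y. q * ?D (g y))"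
    by simp
  also have "\<dots> \<le> integral {Y..2 * Y} (\<lambda>y. g' y *\<^sub>R ?D (g y))"
  proof (rule integral_le)
    show "(\<lambda>y. q * ?D (g y)) integrable_on {Y..2 * Y}"
      unfolding g_def by (intro integrable_continuous_interval continuous_intros cont)
    show "q * ?D (g y) \<le> g' y *\<^sub>R ?D (g y)" if "y \<in> {Y..2 * Y}" for y
    proof -
      have "q \<le> g' y"
        unfolding q_def g'_def using that \<open>Y > 0\<close> c by (intro mult_left_mono power_mono) auto
      then show ?thesis
        using dirichlet_bound_nonneg[OF \<open>W > 0\<close>] by (simp add: mult_right_mono)
    qed
  qed (use subst in auto)
  also have "\<dots> = integral {g Y..g (2 * Y)} ?D"
    by (rule integral_unique[OF subst])
  also have "\<dots> \<le> (g (2 * Y) - g Y + 2) * (4 * ln (1 + W))"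
    using g_mono \<open>Y > 0\<close> by (intro integral_dirichlet_bound_le assms) auto
  also have "\<dots> \<le> (c * (2 ^ k * Y ^ k) + 2) * (4 * ln (1 + W))"
  proof (rule mult_right_mono)
    have "g (2 * Y) - g Y = c * (2 ^ k * Y ^ k) - c * Y ^ k"
      by (simp add: g_def algebra_simps)
    moreover have "c * Y ^ k \<ge> 0"
      using c \<open>Y > 0\<close> by simp
    ultimately show "g (2 * Y) - g Y + 2 \<le> c * (2 ^ k * Y ^ k) + 2"
      by linarith
  qed (use assms in auto)
  finally have "integral {Y..2 * Y} (\<lambda>y. ?D (g y)) \<le> (c * (2 ^ k * Y ^ k) + 2) / q * (4 * ln (1 + W))"
    using q by (simp add: pos_le_divide_eq mult.commute)
  also have "\<dots> \<le> (2 ^ k * Y + 1 / (\<bar>of_int h\<bar> * Y ^ (k - 1))) * (4 * ln (1 + W))"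
  proof (rule mult_right_mono)
    have "Y ^ k = Y * Y ^ (k - 1)"
      using \<open>k \<ge> 2\<close> by (simp flip: power_Suc)
    then have "(c * (2 ^ k * Y ^ k) + 2) / q = (2 ^ k * Y + 1 / (\<bar>of_int h\<bar> * Y ^ (k - 1))) / real k"
      using assms by (simp add: q_def c_def field_simps)
    also have "\<dots> \<le> (2 ^ k * Y + 1 / (\<bar>of_int h\<bar> * Y ^ (k - 1))) / 1"
      using assms by (intro divide_left_mono) auto
    finally show "(c * (2 ^ k * Y ^ k) + 2) / q \<le> 2 ^ k * Y + 1 / (\<bar>of_int h\<bar> * Y ^ (k - 1))"
      by simp
  qed (use assms in auto)
  finally show ?thesis
    by (simp only: D)
qed

text \<open>The shift \<open>h = 0\<close> has no oscillation and contributes \<open>2 * W\<close>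
  on length \<open>Y\<close>. For the others, the terms in \<open>Y\<close> are multiplied by the
  number of shifts, while those in \<open>1 / \<bar>h\<bar>\<close> sum to a harmonic
  number.\<close>

lemma integral_kernel_square_le:
  fixes x Y :: real
  assumes "k \<ge> 2" "Y > 0"
  shows "integral {Y..2 * Y} (\<lambda>y. (norm (\<Sum>n\<in>{- int N..int N}. osc k n x * cnj (osc k n y)))\<^sup>2)
      \<le> 2 * (2 * real N + 1) * Y
        + (4 * real N * 2 ^ k * Y + 2 * harm (4 * N) / Y ^ (k - 1)) * (4 * ln (2 * real N + 2))"
proof -
  let ?B = "{- int (2 * N)..int (2 * N)}"
  define W where "W = 2 * real N + 1"
  have W: "W > 0"
    by (simp add: W_def)
  let ?D = "dirichlet_bound W"
  have osc: "osc k n x * cnj (osc k n y) = ch (of_int n * (x - y) - (of_int n)\<^sup>2 * (x ^ k - y ^ k))" for n y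
    unfolding osc_def ch_diff[symmetric] by (rule arg_cong[of _ _ ch]) (simp add: algebra_simps)
  have cont: "continuous_on S (\<lambda>y. ?D (2 * of_int h * (x ^ k - y ^ k)))" for S h
    by (intro continuous_on_dirichlet_bound W continuous_intros)
  have "integral {Y..2 * Y} (\<lambda>y. (norm (\<Sum>n\<in>{- int N..int N}. osc k n x * cnj (osc k n y)))\<^sup>2)
      \<le> integral {Y..2 * Y} (\<lambda>y. \<Sum>h\<in>?B. ?D (2 * of_int h * (x ^ k - y ^ k)))"
  proof (rule integral_le)
    show "(norm (\<Sum>n\<in>{- int N..int N}. osc k n x * cnj (osc k n y)))\<^sup>2
        \<le> (\<Sum>h\<in>?B. ?D (2 * of_int h * (x ^ k - y ^ k)))" for y
      unfolding osc W_def using weyl_differencing[of "x - y" "x ^ k - y ^ k" N] by simp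
  qed (intro integrable_continuous_interval continuous_intros cont)+
  also have "\<dots> = (\<Sum>h\<in>?B. integral {Y..2 * Y} (\<lambda>y. ?D (2 * of_int h * (x ^ k - y ^ k))))"
    by (intro integral_sum integrable_continuous_interval cont) auto
  also have "\<dots> = integral {Y..2 * Y} (\<lambda>y. ?D 0)
      + (\<Sum>h\<in>?B - {0}. integral {Y..2 * Y} (\<lambda>y. ?D (2 * of_int h * (x ^ k - y ^ k))))"
    by (subst sum.remove[where x = 0]) auto
  also have "\<dots> \<le> 2 * W * Y
      + (\<Sum>h\<in>?B - {0}. (2 ^ k * Y + 1 / (\<bar>of_int h\<bar> * Y ^ (k - 1))) * (4 * ln (1 + W)))"
    using W assms
    by (intro add_mono sum_mono integral_dirichlet_bound_phase) (auto simp: dirichlet_bound_def)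
  also have "(\<Sum>h\<in>?B - {0}. (2 ^ k * Y + 1 / (\<bar>of_int h\<bar> * Y ^ (k - 1))) * (4 * ln (1 + W)))
      = (real (card (?B - {0})) * (2 ^ k * Y) + (\<Sum>h\<in>?B - {0}. 1 / \<bar>of_int h\<bar>) / Y ^ (k - 1)) * (4 * ln (1 + W))"
    by (simp add: sum_distrib_right[symmetric] sum.distrib sum_divide_distrib)
  also have "real (card (?B - {0})) = 4 * real N"
    by simp
  also have "2 * W * Y + (4 * real N * (2 ^ k * Y) + (\<Sum>h\<in>?B - {0}. 1 / \<bar>of_int h\<bar>) / Y ^ (k - 1)) * (4 * ln (1 + W))
      \<le> 2 * W * Y + (4 * real N * (2 ^ k * Y) + 2 * harm (2 * (2 * N)) / Y ^ (k - 1)) * (4 * ln (1 + W))"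
    using sum_inverse_diff_le_harm[of 0 "2 * N"] W assms
    by (intro add_left_mono mult_right_mono divide_right_mono) auto
  finally show ?thesis
    by (simp add: W_def algebra_simps)
qed

lemma norm_exp_sum_squared_le:
  "(norm (exp_sum k N a x))\<^sup>2 \<le> (2 * real N + 1) * (\<Sum>n\<in>{- int N..int N}. (norm (a n))\<^sup>2)"
proof -
  have "(norm (exp_sum k N a x))\<^sup>2 \<le> real (card {- int N..int N}) * (\<Sum>n\<in>{- int N..int N}. (norm (a n * osc k n x))\<^sup>2)"
    unfolding exp_sum_osc by (rule norm_sum_squared_le_card)
  then show ?thesis
    by (simp add: norm_mult)
qed

lemma continuous_on_exp_sum [continuous_intros]: "continuous_on S (exp_sum k N a)"
  unfolding exp_sum_osc[abs_def] by (intro continuous_intros)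

text \<open>The last hypothesis keeps \<open>Y\<close> above the inner scale and makes
  \<open>1 / Y^(k-1)\<close> at most a multiple of \<open>N\<close>, so every term of the kernel
  estimate is \<open>N\<close> times logarithms.\<close>

lemma l4_dyadic_bound:
  fixes a :: "int \<Rightarrow> complex"
  assumes "k \<ge> 2" "N \<ge> 1" "Y > 0" "Y \<le> 1 / 2" "4 * real k * real N * (2 * Y) ^ (k - 1) \<ge> 1"
  shows "integral {Y..2 * Y} (\<lambda>x. norm (exp_sum k N a x) ^ 4)
      \<le> real k * 2 ^ (k + 6) * real N * (1 + harm (4 * N)) * (1 + ln (2 * real N + 2))
        * (\<Sum>n\<in>{- int N..int N}. (norm (a n))\<^sup>2)\<^sup>2"
  unfolding exp_sum_osc
proof (rule l4_bound_by_kernel)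
  fix x
  let ?H = "harm (4 * N) :: real" and ?L = "ln (2 * real N + 2)"
  have H: "?H \<ge> 0" and L: "?L \<ge> 0"
    by (simp_all add: harm_nonneg)
  have Y: "1 / Y ^ (k - 1) \<le> real k * 2 ^ (k + 1) * real N"
  proof -
    have "2 ^ (k + 1) = 4 * (2 :: real) ^ (k - 1)"
      using \<open>k \<ge> 2\<close> by (cases k) auto
    then have "1 \<le> (real k * 2 ^ (k + 1) * real N) * Y ^ (k - 1)"
      using assms(5) by (simp add: power_mult_distrib mult_ac)
    then show ?thesis
      using \<open>Y > 0\<close> by (simp add: pos_divide_le_eq)
  qed
  have "integral {Y..2 * Y} (\<lambda>y. (norm (\<Sum>n\<in>{- int N..int N}. osc k n x * cnj (osc k n y)))\<^sup>2)
      \<le> 2 * (2 * real N + 1) * Y + (4 * real N * 2 ^ k * Y + 2 * ?H / Y ^ (k - 1)) * (4 * ?L)"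
    using assms by (intro integral_kernel_square_le) auto
  also have "\<dots> \<le> 2 * (3 * real N) * (1 / 2) + (4 * real N * 2 ^ k * (1 / 2) + 2 * ?H * (real k * 2 ^ (k + 1) * real N)) * (4 * ?L)"
    using assms H L mult_left_mono[OF Y, of "2 * ?H"]
    by (intro add_mono mult_mono mult_nonneg_nonneg add_nonneg_nonneg) auto
  also have "\<dots> = real N * (3 + 2 ^ k * (8 * ?L) + real k * 2 ^ k * (16 * (?H * ?L)))"
    by (simp add: algebra_simps)
  \<comment> \<open>The missing terms are padded in so that the whole expression factors through
    \<open>(1 + ?H) * (1 + ?L)\<close>.\<close>
  also have "\<dots> \<le> real N * (real k * 2 ^ k * 64 + real k * 2 ^ k * (64 * ?L) + real k * 2 ^ k * (64 * (?H * ?L)) + real k * 2 ^ k * (64 * ?H))"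
  proof (rule mult_left_mono)
    have one: "1 \<le> real k * 2 ^ k"
      using \<open>k \<ge> 2\<close> mult_mono[of 1 "real k" 1 "2 ^ k"] by simp
    have kk: "2 ^ k \<le> real k * 2 ^ k"
      using \<open>k \<ge> 2\<close> by simp
    have "2 ^ k * (8 * ?L) \<le> real k * 2 ^ k * (64 * ?L)"
      using L kk by (intro mult_mono) auto
    moreover have "real k * 2 ^ k * (16 * (?H * ?L)) \<le> real k * 2 ^ k * (64 * (?H * ?L))"
      using H L by (intro mult_left_mono) auto
    moreover have "0 \<le> real k * 2 ^ k * (64 * ?H)"
      using H by simp
    ultimately show "3 + 2 ^ k * (8 * ?L) + real k * 2 ^ k * (16 * (?H * ?L))
        \<le> real k * 2 ^ k * 64 + real k * 2 ^ k * (64 * ?L) + real k * 2 ^ k * (64 * (?H * ?L)) + real k * 2 ^ k * (64 * ?H)"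
      using one by linarith
  qed simp
  also have "\<dots> = real k * 2 ^ (k + 6) * real N * (1 + ?H) * (1 + ?L)"
    by (simp add: power_add algebra_simps)
  finally show "integral {Y..2 * Y} (\<lambda>y. (norm (\<Sum>n\<in>{- int N..int N}. osc k n x * cnj (osc k n y)))\<^sup>2)
      \<le> real k * 2 ^ (k + 6) * real N * (1 + ?H) * (1 + ?L)" .
qed (use assms in \<open>auto intro!: continuous_intros\<close>)

text \<open>Two of the four factors are estimated by the supremum, whose square is at most
  \<open>2 * N + 1\<close> times the square sum. This loses nothing at the exponent 4, since the
  remaining square integral has only a logarithmic loss.\<close>

lemma l4_inner_bound:
  fixes a :: "int \<Rightarrow> complex"
  assumes "k \<ge> 2" "0 \<le> t" "t \<le> 1" "4 * real k * real N * t ^ (k - 1) \<le> 1"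
  shows "integral {0..t} (\<lambda>x. norm (exp_sum k N a x) ^ 4)
      \<le> (2 * real N + 1) * (1 + 4 * harm (2 * N)) * (\<Sum>n\<in>{- int N..int N}. (norm (a n))\<^sup>2)\<^sup>2"
proof -
  let ?S = "\<Sum>n\<in>{- int N..int N}. (norm (a n))\<^sup>2"
  have S: "?S \<ge> 0"
    by (intro sum_nonneg) auto
  have "integral {0..t} (\<lambda>x. norm (exp_sum k N a x) ^ 4)
      \<le> integral {0..t} (\<lambda>x. (2 * real N + 1) * ?S * (norm (exp_sum k N a x))\<^sup>2)"
  proof (rule integral_le)
    fix x
    have "(norm (exp_sum k N a x))\<^sup>2 * (norm (exp_sum k N a x))\<^sup>2
        \<le> (2 * real N + 1) * ?S * (norm (exp_sum k N a x))\<^sup>2"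
      by (intro mult_right_mono norm_exp_sum_squared_le) simp
    then show "norm (exp_sum k N a x) ^ 4 \<le> (2 * real N + 1) * ?S * (norm (exp_sum k N a x))\<^sup>2"
      by (simp flip: power_add)
  qed (intro integrable_continuous_interval continuous_intros)+
  also have "\<dots> = (2 * real N + 1) * ?S * integral {0..t} (\<lambda>x. (norm (exp_sum k N a x))\<^sup>2)"
    by (rule integral_mult_right)
  also have "\<dots> \<le> (2 * real N + 1) * ?S * ((1 + 4 * harm (2 * N)) * ?S)"
    using S by (intro mult_left_mono inner_l2_bound assms) auto
  finally show ?thesis
    by (simp add: power2_eq_square mult_ac)
qed

section \<open>Bounds with logarithmic losses and interpolation\<close>

lemma l2_bound:
  fixes a :: "int \<Rightarrow> complex"
  assumes "k \<ge> 2" "N \<ge> 1"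
  shows "integral {0..1} (\<lambda>x. (norm (exp_sum k N a x))\<^sup>2)
      \<le> 81 * real N powr ((real k - 2) / (3 * (real k - 1))) * (1 + ln (real N))
        * (\<Sum>n\<in>{- int N..int N}. (norm (a n))\<^sup>2)"
proof -
  let ?S = "\<Sum>n\<in>{- int N..int N}. (norm (a n))\<^sup>2"
  define \<beta> where "\<beta> = (real k - 2) / (3 * (real k - 1))"
  have \<beta>: "\<beta> \<ge> 0" "1 - 1 / real (k - 1) = 3 * \<beta>"
    using \<open>k \<ge> 2\<close> by (auto simp: \<beta>_def field_simps)
  define P where "P = real N powr \<beta>"
  have P: "P \<ge> 1"
    using \<beta> \<open>N \<ge> 1\<close> by (simp add: P_def ge_one_powr_ge_zero)
  \<comment> \<open>With \<open>P^3 = N^(1 - 1/(k-1))\<close>, the strip contributes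
    \<open>8 * \<tau>^2 * P^3 = 2 * P\<close> and the off-fold part a logarithm times
    \<open>1 / \<tau> = 2 * P\<close>. As \<open>P \<ge> 1\<close>, the condition
    \<open>\<tau> \<le> 1 / 2\<close> holds.\<close>
  define \<tau> where "\<tau> = 1 / (2 * P)"
  define E where "E = 1 + ln (real N)"
  have E: "E \<ge> 1"
    using \<open>N \<ge> 1\<close> by (simp add: E_def)
  have S: "?S \<ge> 0"
    by (intro sum_nonneg) auto
  have "real N powr (3 * \<beta>) = P ^ 3"
    using \<open>N \<ge> 1\<close> by (simp add: P_def powr_powr mult.commute flip: powr_numeral)
  then have third: "8 * \<tau>\<^sup>2 * real N powr (1 - 1 / real (k - 1)) = 2 * P"
    unfolding \<beta>(2) using P by (simp add: \<tau>_def power2_eq_square power3_eq_cube)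
  have H: "harm (2 * N) \<le> 2 * E"
  proof -
    have "harm (2 * N) \<le> 1 + ln (2 * real N)"
      using harm_le_ln[of "2 * N"] \<open>N \<ge> 1\<close> by simp
    also have "ln (2 * real N) = ln 2 + ln (real N)"
      using \<open>N \<ge> 1\<close> by (simp add: ln_mult)
    finally show ?thesis
      using ln_2_less_1 E unfolding E_def distrib_left by linarith
  qed
  have "integral {0..1} (\<lambda>x. (norm (exp_sum k N a x))\<^sup>2)
      \<le> 3 * (3 + 4 * harm (2 * N) / \<tau> + 8 * \<tau>\<^sup>2 * real N powr (1 - 1 / real (k - 1))) * ?S"
    using assms P by (intro l2_bound_cutoff) (auto simp: \<tau>_def)
  also have "\<dots> = 3 * (3 + 8 * harm (2 * N) * P + 2 * P) * ?S"
    unfolding third by (simp add: \<tau>_def)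
  also have "\<dots> \<le> 3 * (27 * (P * E)) * ?S"
  proof (intro mult_right_mono mult_left_mono S)
    have "8 * harm (2 * N) * P \<le> 8 * (2 * E) * P"
      using H P by (intro mult_right_mono mult_left_mono) auto
    moreover have "1 \<le> P * E" "P \<le> P * E"
      using P E mult_mono[of 1 P 1 E] mult_left_mono[of 1 E P] by auto
    ultimately show "3 + 8 * harm (2 * N) * P + 2 * P \<le> 27 * (P * E)"
      by (simp add: mult_ac)
  qed auto
  finally show ?thesis
    by (simp add: P_def E_def \<beta>_def mult_ac)
qed

lemma l4_bound:
  assumes "k \<ge> 2"
  obtains C where "C > 0"
    and "\<And>N a. N \<ge> 1 \<Longrightarrow> integral {0..1} (\<lambda>x. norm (exp_sum k N a x) ^ 4)
      \<le> C * real N * (1 + ln (real N)) ^ 3 * (\<Sum>n\<in>{- int N..int N}. (norm (a n))\<^sup>2)\<^sup>2"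
proof
  \<comment> \<open>\<open>c * E\<close> will bound the number of dyadic scales, about
    \<open>2 * ln (4 * k * N)\<close>, and \<open>d\<close> is the constant of a single scale, with
    12 coming from the bounds \<open>4 * E\<close> and \<open>3 * E\<close> for its two logarithmic
    factors. The 27 belongs to the inner interval.\<close>
  define c where "c = 3 + 2 * ln (4 * real k)"
  define d where "d = real k * 2 ^ (k + 6) * 12"
  have c: "c > 0"
    using \<open>k \<ge> 2\<close> by (simp add: c_def add_pos_nonneg)
  have d: "d > 0"
    using \<open>k \<ge> 2\<close> by (simp add: d_def)
  show "27 + c * d > 0"
    using c d by (simp add: add_pos_pos)
  fix N :: nat and a :: "int \<Rightarrow> complex"
  assume N: "N \<ge> 1"
  let ?S = "\<Sum>n\<in>{- int N..int N}. (norm (a n))\<^sup>2"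
  let ?f = "\<lambda>x. norm (exp_sum k N a x) ^ 4"
  have f_int: "?f integrable_on {x..y}" for x y
    by (intro integrable_continuous_interval continuous_intros)
  define E where "E = 1 + ln (real N)"
  have E: "E \<ge> 1"
    using N by (simp add: E_def)
  have ln2: "1 / 2 \<le> ln (2 :: real)" "ln (2 :: real) \<le> 1"
    using ln2_ge_two_thirds ln_2_less_1 by auto
  have ln_mult_N: "ln (r * real N) = ln r + ln (real N)" if "r > 0" for r
    using that N by (simp add: ln_mult)
  have ln4: "ln (4 :: real) \<le> 2"
    using ln2 ln_realpow[of 2 2] by simp
  have H2: "harm (2 * N) \<le> 2 * E"
  proof -
    have "harm (2 * N) \<le> 1 + ln (2 * real N)"
      using harm_le_ln[of "2 * N"] N by simp
    then show ?thesis
      using ln_mult_N[of 2, OF zero_less_numeral] ln2 E unfolding E_def distrib_left by linarith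
  qed
  have H4: "1 + harm (4 * N) \<le> 4 * E"
  proof -
    have "harm (4 * N) \<le> 1 + ln (4 * real N)"
      using harm_le_ln[of "4 * N"] N by simp
    then show ?thesis
      using ln_mult_N[of 4, OF zero_less_numeral] ln4 E unfolding E_def distrib_left by linarith
  qed
  have L: "1 + ln (2 * real N + 2) \<le> 3 * E"
  proof -
    have "ln (2 * real N + 2) \<le> ln (4 * real N)"
      using N by simp
    then show ?thesis
      using ln_mult_N[of 4, OF zero_less_numeral] ln4 E unfolding E_def distrib_left by linarith
  qed
  \<comment> \<open>\<open>Q j\<close> says that \<open>[0, 1 / 2^j]\<close> is short enough for the
    inner estimate.\<close>
  define Q where "Q j \<longleftrightarrow> 4 * real k * real N * (1 / 2 ^ j) ^ (k - 1) \<le> 1" for j :: nat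
  define i where "i = nat \<lceil>log 2 (4 * real k * real N)\<rceil>"
  have kN: "4 * real k * real N \<ge> 1"
    using \<open>k \<ge> 2\<close> N mult_mono[of 1 "4 * real k" 1 "real N"] by simp
  have i: "log 2 (4 * real k * real N) \<le> real i" "real i \<le> log 2 (4 * real k * real N) + 1"
    using kN zero_le_log_cancel_iff[of 2 "4 * real k * real N"] unfolding i_def by linarith+
  have "Q i"
  proof -
    have "4 * real k * real N \<le> 2 ^ i"
    proof -
      have "4 * real k * real N = 2 powr log 2 (4 * real k * real N)"
        using kN by (intro powr_log_cancel[symmetric]) linarith+
      also have "\<dots> \<le> 2 powr real i"
        using i(1) by (intro powr_mono) auto
      finally show ?thesis
        by (simp only: powr_realpow zero_less_numeral)
    qed
    moreover have "(1 / 2 ^ i :: real) ^ (k - 1) \<le> (1 / 2 ^ i) ^ 1"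
      using \<open>k \<ge> 2\<close> by (intro power_decreasing) auto
    ultimately have "4 * real k * real N * (1 / 2 ^ i) ^ (k - 1) \<le> 2 ^ i * (1 / 2 ^ i) ^ 1"
      by (intro mult_mono) auto
    then show ?thesis
      by (simp add: Q_def)
  qed
  \<comment> \<open>The least index is taken so that the failure of \<open>Q\<close> at every
    \<open>j < I\<close> is exactly the hypothesis of the dyadic estimate with
    \<open>2 * Y = 1 / 2^j\<close>. The explicit index \<open>i\<close> shows existence and gives
    the logarithmic bound on \<open>I\<close>.\<close>
  define I where "I = (LEAST j. Q j)"
  have "Q I"
    unfolding I_def using \<open>Q i\<close> by (rule LeastI)
  have "I \<le> i"
    unfolding I_def using \<open>Q i\<close> by (rule Least_le)
  have not_Q: "\<not> Q j" if "j < I" for j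
    using that unfolding I_def by (rule not_less_Least)
  have I_le: "real I \<le> c * E"
  proof -
    have "log 2 (4 * real k * real N) = (ln (4 * real k) + ln (real N)) / ln 2"
      using ln_mult_N[of "4 * real k"] \<open>k \<ge> 2\<close> by (simp add: log_def)
    also have "\<dots> \<le> (ln (4 * real k) + ln (real N)) / (1 / 2)"
      using ln2 \<open>k \<ge> 2\<close> N by (intro divide_left_mono add_nonneg_nonneg) auto
    finally have "real I \<le> 2 * (ln (4 * real k) + ln (real N)) + 1"
      using i(2) \<open>I \<le> i\<close> by simp
    also have "\<dots> \<le> c * E"
    proof -
      have "0 \<le> ln (4 * real k) * ln (real N)"
        using N \<open>k \<ge> 2\<close> by simp
      then show ?thesis
        using N by (simp add: c_def E_def algebra_simps)
    qed
    finally show ?thesis .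
  qed
  define M where "M = real k * 2 ^ (k + 6) * real N * (1 + harm (4 * N)) * (1 + ln (2 * real N + 2))"
  have M: "M \<le> d * real N * E\<^sup>2"
  proof -
    have "M \<le> real k * 2 ^ (k + 6) * real N * (4 * E) * (3 * E)"
      unfolding M_def using H4 L E by (intro mult_mono mult_nonneg_nonneg) (auto simp: harm_nonneg add_nonneg_nonneg)
    then show ?thesis
      by (simp add: d_def power2_eq_square mult_ac)
  qed
  have outer: "integral {1 / 2 ^ j..1} ?f \<le> real j * (M * ?S\<^sup>2)" if "j \<le> I" for j
    using that
  proof (induction j)
    case (Suc j)
    let ?Y = "1 / 2 ^ Suc j :: real"
    have Y2: "2 * ?Y = 1 / 2 ^ j"
      by simp
    have "integral {?Y..1} ?f = integral {?Y..2 * ?Y} ?f + integral {2 * ?Y..1} ?f"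
      by (intro Henstock_Kurzweil_Integration.integral_combine[symmetric] f_int) (auto simp: field_simps)
    also have "integral {?Y..2 * ?Y} ?f \<le> M * ?S\<^sup>2"
      unfolding M_def
    proof (rule l4_dyadic_bound)
      show "1 \<le> 4 * real k * real N * (2 * ?Y) ^ (k - 1)"
        unfolding Y2 using not_Q[of j] Suc.prems by (simp add: Q_def)
      show "?Y \<le> 1 / 2"
        by (simp add: field_simps)
    qed (use N \<open>k \<ge> 2\<close> in auto)
    also have "integral {2 * ?Y..1} ?f \<le> real j * (M * ?S\<^sup>2)"
      unfolding Y2 using Suc by simp
    finally show ?case
      by (simp add: algebra_simps)
  qed simp
  have "integral {0..1} ?f = integral {0..1 / 2 ^ I} ?f + integral {1 / 2 ^ I..1} ?f"
    by (intro Henstock_Kurzweil_Integration.integral_combine[symmetric] f_int) auto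
  also have "\<dots> \<le> (2 * real N + 1) * (1 + 4 * harm (2 * N)) * ?S\<^sup>2 + real I * (M * ?S\<^sup>2)"
    using \<open>Q I\<close> \<open>k \<ge> 2\<close> by (intro add_mono outer l4_inner_bound) (auto simp: Q_def)
  also have "\<dots> = ((2 * real N + 1) * (1 + 4 * harm (2 * N)) + real I * M) * ?S\<^sup>2"
    by (simp add: algebra_simps)
  also have "\<dots> \<le> ((3 * real N) * (9 * E) + (c * E) * (d * real N * E\<^sup>2)) * ?S\<^sup>2"
  proof (intro mult_right_mono add_mono)
    show "(2 * real N + 1) * (1 + 4 * harm (2 * N)) \<le> (3 * real N) * (9 * E)"
      using N E H2 by (intro mult_mono) (auto simp: harm_nonneg add_nonneg_nonneg)
    have "0 \<le> M"
      by (simp add: M_def harm_nonneg add_nonneg_nonneg)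
    then show "real I * M \<le> (c * E) * (d * real N * E\<^sup>2)"
      using c E by (intro mult_mono I_le M) auto
  qed auto
  also have "\<dots> \<le> ((3 * real N) * (9 * E ^ 3) + (c * E) * (d * real N * E\<^sup>2)) * ?S\<^sup>2"
    using E by (intro mult_right_mono add_right_mono mult_left_mono self_le_power) auto
  finally show "integral {0..1} ?f \<le> (27 + c * d) * real N * (1 + ln (real N)) ^ 3 * ?S\<^sup>2"
    by (simp add: algebra_simps power2_eq_square power3_eq_cube flip: E_def)
qed

section \<open>Absorbing logarithms and interpolating between exponents\<close>

lemma log_power_le_powr:
  fixes \<delta> :: real
  assumes "\<delta> > 0" "N \<ge> 1"
  shows "(1 + ln (real N)) ^ 3 \<le> (1 + 3 / \<delta>) ^ 3 * real N powr \<delta>"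
proof -
  have "ln (real N) \<le> real N powr (\<delta> / 3) / (\<delta> / 3)"
    using assms by (intro ln_powr_bound) auto
  moreover have "1 \<le> real N powr (\<delta> / 3)"
    using assms by (simp add: ge_one_powr_ge_zero)
  ultimately have "1 + ln (real N) \<le> (1 + 3 / \<delta>) * real N powr (\<delta> / 3)"
    by (simp add: distrib_right mult.commute)
  then have "(1 + ln (real N)) ^ 3 \<le> ((1 + 3 / \<delta>) * real N powr (\<delta> / 3)) ^ 3"
    using assms by (intro power_mono) auto
  also have "\<dots> = (1 + 3 / \<delta>) ^ 3 * real N powr \<delta>"
    using assms by (simp add: power_mult_distrib powr_powr flip: powr_numeral)
  finally show ?thesis .
qed

text \<open>Weighted AM-GM, applied pointwise to \<open>g\<^sup>2 / U\<close> and \<open>g\<^sup>4 / V\<close>, replaces Hoelder's inequality.\<close>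

lemma integral_powr_interpolate:
  fixes g :: "real \<Rightarrow> real"
  assumes "continuous_on {0..1} g" "\<And>x. g x \<ge> 0" "U > 0" "V > 0" "2 \<le> p" "p \<le> 4"
    and U: "integral {0..1} (\<lambda>x. (g x)\<^sup>2) \<le> U"
    and V: "integral {0..1} (\<lambda>x. g x ^ 4) \<le> V"
  shows "integral {0..1} (\<lambda>x. g x powr p) \<le> U powr ((4 - p) / 2) * V powr ((p - 2) / 2)"
proof -
  define \<theta> where "\<theta> = (4 - p) / 2"
  have \<theta>: "0 \<le> \<theta>" "0 \<le> 1 - \<theta>" "1 - \<theta> = (p - 2) / 2" "2 * \<theta> + 4 * (1 - \<theta>) = p"
    using assms by (auto simp: \<theta>_def field_simps)
  define B where "B = U powr \<theta> * V powr (1 - \<theta>)"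
  have "B > 0"
    using assms by (simp add: B_def)
  have g2: "(\<lambda>x. (g x)\<^sup>2) integrable_on {0..1}" and g4: "(\<lambda>x. g x ^ 4) integrable_on {0..1}"
    using assms(1) by (auto intro!: integrable_continuous_interval continuous_intros)
  have "integral {0..1} (\<lambda>x. g x powr p) \<le> integral {0..1} (\<lambda>x. B * (\<theta> / U * (g x)\<^sup>2 + (1 - \<theta>) / V * g x ^ 4))"
  proof (rule integral_le)
    show "(\<lambda>x. g x powr p) integrable_on {0..1}"
      using assms by (intro integrable_continuous_interval continuous_on_powr' continuous_intros) auto
    show "(\<lambda>x. B * (\<theta> / U * (g x)\<^sup>2 + (1 - \<theta>) / V * g x ^ 4)) integrable_on {0..1}"
      by (intro integrable_on_mult_right integrable_add g2 g4)
    fix x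
    show "g x powr p \<le> B * (\<theta> / U * (g x)\<^sup>2 + (1 - \<theta>) / V * g x ^ 4)"
    proof (cases "g x = 0")
      case False
      with assms(2)[of x] have gx: "g x > 0"
        by simp
      have "((g x)\<^sup>2 / U) powr \<theta> * (g x ^ 4 / V) powr (1 - \<theta>) \<le> \<theta> * ((g x)\<^sup>2 / U) + (1 - \<theta>) * (g x ^ 4 / V)"
        using gx assms \<theta> by (intro Youngs_inequality_0) auto
      moreover have "((g x)\<^sup>2 / U) powr \<theta> * (g x ^ 4 / V) powr (1 - \<theta>) = g x powr p / B"
      proof -
        have "(g x)\<^sup>2 powr \<theta> * (g x ^ 4) powr (1 - \<theta>) = g x powr (2 * \<theta>) * g x powr (4 * (1 - \<theta>))"
          using gx by (simp add: powr_powr flip: powr_numeral)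
        also have "\<dots> = g x powr p"
          by (simp only: \<theta>(4) flip: powr_add)
        finally show ?thesis
          using gx assms by (simp add: powr_divide B_def)
      qed
      ultimately show ?thesis
        using \<open>B > 0\<close> by (simp add: pos_divide_le_eq mult.commute)
    qed (use assms in auto)
  qed
  also have "\<dots> = B * (\<theta> / U * integral {0..1} (\<lambda>x. (g x)\<^sup>2) + (1 - \<theta>) / V * integral {0..1} (\<lambda>x. g x ^ 4))"
    by (intro integral_unique has_integral_mult_right has_integral_add integrable_integral g2 g4)
  also have "\<dots> \<le> B * (\<theta> / U * U + (1 - \<theta>) / V * V)"
    using \<theta> U V assms \<open>B > 0\<close> by (intro mult_left_mono add_mono divide_nonneg_pos) auto
  also have "\<dots> = B"
    using assms by simp
  finally show ?thesis
    by (simp add: B_def \<theta>(3)) (simp add: \<theta>_def)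
qed

lemma integral_powr_le_sup:
  fixes g :: "real \<Rightarrow> real"
  assumes "continuous_on {0..1} g" "\<And>x. 0 \<le> g x" "\<And>x. g x \<le> B" "4 \<le> p"
    and V: "integral {0..1} (\<lambda>x. g x ^ 4) \<le> V"
  shows "integral {0..1} (\<lambda>x. g x powr p) \<le> B powr (p - 4) * V"
proof -
  have "integral {0..1} (\<lambda>x. g x powr p) \<le> integral {0..1} (\<lambda>x. B powr (p - 4) * g x ^ 4)"
  proof (rule integral_le)
    show "(\<lambda>x. g x powr p) integrable_on {0..1}"
      using assms by (intro integrable_continuous_interval continuous_on_powr' continuous_intros) auto
    show "(\<lambda>x. B powr (p - 4) * g x ^ 4) integrable_on {0..1}"
      by (intro integrable_continuous_interval continuous_intros assms(1))
    fix x
    show "g x powr p \<le> B powr (p - 4) * g x ^ 4"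
    proof (cases "g x = 0")
      case False
      with assms(2)[of x] have "g x > 0"
        by simp
      then have "g x powr p = g x powr (p - 4) * g x ^ 4"
        by (simp flip: powr_add powr_numeral)
      also have "\<dots> \<le> B powr (p - 4) * g x ^ 4"
        using assms by (intro mult_right_mono powr_mono2) auto
      finally show ?thesis .
    qed auto
  qed
  also have "\<dots> = B powr (p - 4) * integral {0..1} (\<lambda>x. g x ^ 4)"
    by (rule integral_mult_right)
  also have "\<dots> \<le> B powr (p - 4) * V"
    using V by (intro mult_left_mono) auto
  finally show ?thesis .
qed

lemma l2_norm_squared: "(l2_norm N a)\<^sup>2 = (\<Sum>n\<in>{- int N..int N}. (norm (a n))\<^sup>2)"
  unfolding l2_norm_def by (intro real_sqrt_pow2 sum_nonneg) auto

lemma l2_norm_nonneg: "l2_norm N a \<ge> 0"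
  unfolding l2_norm_def by (intro real_sqrt_ge_zero sum_nonneg) auto

lemma exp_sum_eq_0_if_l2_norm_eq_0:
  assumes "l2_norm N a = 0"
  shows "exp_sum k N a x = 0"
proof -
  have "(\<Sum>n\<in>{- int N..int N}. (norm (a n))\<^sup>2) = 0"
    using l2_norm_squared[of N a] assms by simp
  then have "\<forall>n\<in>{- int N..int N}. (norm (a n))\<^sup>2 = 0"
    by (subst (asm) sum_nonneg_eq_0_iff) auto
  then show ?thesis
    by (simp add: exp_sum_def)
qed

text \<open>This is the origin of \<open>\<alpha>\<close> on \<open>2 \<le> p \<le> 4\<close>: the
  exponents of the square integral and of the fourth power integral, the latter being 1, are
  averaged with the interpolation weights and divided by \<open>p\<close>.\<close>

lemma \<alpha>_interpolation:
  assumes "k \<ge> 2" "2 \<le> p" "p \<le> 4"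
  shows "(real k - 2) / (3 * (real k - 1)) * ((4 - p) / 2) + (p - 2) / 2 = p * \<alpha> k p"
proof -
  have "real k - 1 \<noteq> 0" "p \<noteq> 0"
    using assms by auto
  then show ?thesis
    using assms by (simp add: \<alpha>_def divide_simps) (simp add: algebra_simps)
qed

text \<open>The loss \<open>\<delta>\<close> refers to the integral before the root is taken. Both
  endpoint estimates carry the same \<open>N^\<delta>\<close> and the interpolation weights add up
  to 1, so the loss is not increased; for \<open>p > 4\<close> only the fourth power estimate brings
  it in.\<close>

lemma half_interval_bound:
  assumes "k \<ge> 2" "p \<ge> 2" "\<delta> > 0"
  obtains C where "C > 0"
    and "\<And>N a. N \<ge> 1 \<Longrightarrow> integral {0..1} (\<lambda>x. norm (exp_sum k N a x) powr p)
      \<le> C * real N powr (p * \<alpha> k p + \<delta>) * l2_norm N a powr p"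
proof -
  obtain C4 where C4: "C4 > 0"
    and l4: "\<And>N a. N \<ge> 1 \<Longrightarrow> integral {0..1} (\<lambda>x. norm (exp_sum k N a x) ^ 4)
      \<le> C4 * real N * (1 + ln (real N)) ^ 3 * (\<Sum>n\<in>{- int N..int N}. (norm (a n))\<^sup>2)\<^sup>2"
    using l4_bound[OF \<open>k \<ge> 2\<close>] by metis
  define \<beta> where "\<beta> = (real k - 2) / (3 * (real k - 1))"
  define K where "K = (1 + 3 / \<delta>) ^ 3"
  have K: "K > 0"
    using \<open>\<delta> > 0\<close> by (simp add: K_def add_pos_pos)
  have cont: "continuous_on {0..1} (\<lambda>x. norm (exp_sum k N a x))" for N a
    by (intro continuous_intros)
  have log: "(1 + ln (real N)) ^ 3 \<le> K * real N powr \<delta>" if "N \<ge> 1" for N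
    unfolding K_def using that \<open>\<delta> > 0\<close> by (intro log_power_le_powr)
  have U: "integral {0..1} (\<lambda>x. (norm (exp_sum k N a x))\<^sup>2) \<le> 81 * K * real N powr (\<beta> + \<delta>) * (l2_norm N a)\<^sup>2"
    if "N \<ge> 1" for N a
  proof -
    have "1 + ln (real N) \<le> (1 + ln (real N)) ^ 3"
      using that by (intro self_le_power) auto
    then have "1 + ln (real N) \<le> K * real N powr \<delta>"
      using log[OF that] by linarith
    then have "81 * real N powr \<beta> * (1 + ln (real N)) * (l2_norm N a)\<^sup>2
        \<le> 81 * real N powr \<beta> * (K * real N powr \<delta>) * (l2_norm N a)\<^sup>2"
      by (intro mult_right_mono mult_left_mono) auto
    then show ?thesis
      using l2_bound[OF \<open>k \<ge> 2\<close> that, of a] unfolding l2_norm_squared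
      by (simp add: \<beta>_def powr_add mult_ac)
  qed
  have V: "integral {0..1} (\<lambda>x. norm (exp_sum k N a x) ^ 4) \<le> C4 * K * real N powr (1 + \<delta>) * l2_norm N a ^ 4"
    if "N \<ge> 1" for N a
  proof -
    have "C4 * real N * (1 + ln (real N)) ^ 3 * ((l2_norm N a)\<^sup>2)\<^sup>2
        \<le> C4 * real N * (K * real N powr \<delta>) * ((l2_norm N a)\<^sup>2)\<^sup>2"
      using log[OF that] C4 by (intro mult_right_mono mult_left_mono) auto
    then show ?thesis
      using l4[OF that, of a] that unfolding l2_norm_squared
      by (simp add: powr_add mult_ac flip: l2_norm_squared power_mult)
  qed
  \<comment> \<open>Treated apart because the later arguments divide by, or take real powers of, the
    size of the coefficients.\<close>
  have zero: "integral {0..1} (\<lambda>x. norm (exp_sum k N a x) powr p)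
      \<le> C * real N powr (p * \<alpha> k p + \<delta>) * l2_norm N a powr p" if "l2_norm N a = 0" for N a C
    using that \<open>p \<ge> 2\<close> by (simp add: exp_sum_eq_0_if_l2_norm_eq_0)
  show ?thesis
  proof (cases "p \<le> 4")
    case True
    define \<theta> where "\<theta> = (4 - p) / 2"
    define \<phi> where "\<phi> = (p - 2) / 2"
    have exps: "(\<beta> + \<delta>) * \<theta> + (1 + \<delta>) * \<phi> = p * \<alpha> k p + \<delta>" "2 * \<theta> + 4 * \<phi> = p"
    proof -
      have "(\<beta> + \<delta>) * \<theta> + (1 + \<delta>) * \<phi> = \<beta> * \<theta> + \<phi> + \<delta> * (\<theta> + \<phi>)"
        by (simp add: algebra_simps)
      also have "\<beta> * \<theta> + \<phi> = p * \<alpha> k p"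
        using \<alpha>_interpolation[OF \<open>k \<ge> 2\<close> \<open>p \<ge> 2\<close> True] by (simp only: \<beta>_def \<theta>_def \<phi>_def)
      also have "\<theta> + \<phi> = 1"
        by (simp add: \<theta>_def \<phi>_def field_simps)
      finally show "(\<beta> + \<delta>) * \<theta> + (1 + \<delta>) * \<phi> = p * \<alpha> k p + \<delta>"
        by simp
    qed (simp add: \<theta>_def \<phi>_def field_simps)
    show ?thesis
    proof (rule that)
      show "(81 * K) powr \<theta> * (C4 * K) powr \<phi> > 0"
        using K C4 by simp
      fix N :: nat and a :: "int \<Rightarrow> complex"
      assume N: "N \<ge> 1"
      show "integral {0..1} (\<lambda>x. norm (exp_sum k N a x) powr p)
          \<le> (81 * K) powr \<theta> * (C4 * K) powr \<phi> * real N powr (p * \<alpha> k p + \<delta>) * l2_norm N a powr p"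
      proof (cases "l2_norm N a = 0")
        case False
        then have A: "l2_norm N a > 0"
          using l2_norm_nonneg[of N a] by simp
        have "integral {0..1} (\<lambda>x. norm (exp_sum k N a x) powr p)
            \<le> (81 * K * real N powr (\<beta> + \<delta>) * (l2_norm N a)\<^sup>2) powr ((4 - p) / 2)
              * (C4 * K * real N powr (1 + \<delta>) * l2_norm N a ^ 4) powr ((p - 2) / 2)"
          using A N K C4 True \<open>p \<ge> 2\<close> U[OF N] V[OF N]
          by (intro integral_powr_interpolate cont) auto
        also have "\<dots> = (81 * K) powr \<theta> * (real N powr ((\<beta> + \<delta>) * \<theta>)) * (l2_norm N a powr (2 * \<theta>))
              * ((C4 * K) powr \<phi> * (real N powr ((1 + \<delta>) * \<phi>)) * (l2_norm N a powr (4 * \<phi>)))"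
          using A N K C4 by (simp add: powr_mult powr_powr \<theta>_def[symmetric] \<phi>_def[symmetric] flip: powr_numeral)
        also have "\<dots> = (81 * K) powr \<theta> * (C4 * K) powr \<phi>
              * real N powr ((\<beta> + \<delta>) * \<theta> + (1 + \<delta>) * \<phi>) * l2_norm N a powr (2 * \<theta> + 4 * \<phi>)"
          unfolding powr_add by (simp only: mult_ac)
        finally show ?thesis
          by (simp only: exps)
      qed (rule zero)
    qed
  next
    case False
    then have p: "p > 4"
      by simp
    show ?thesis
    proof (rule that)
      show "3 powr ((p - 4) / 2) * (C4 * K) > 0"
        using K C4 by simp
      fix N :: nat and a :: "int \<Rightarrow> complex"
      assume N: "N \<ge> 1"
      show "integral {0..1} (\<lambda>x. norm (exp_sum k N a x) powr p)
          \<le> 3 powr ((p - 4) / 2) * (C4 * K) * real N powr (p * \<alpha> k p + \<delta>) * l2_norm N a powr p"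
      proof (cases "l2_norm N a = 0")
        case False
        then have A: "l2_norm N a > 0"
          using l2_norm_nonneg[of N a] by simp
        \<comment> \<open>The Cauchy-Schwarz bound for the supremum, with
          \<open>2 * N + 1 \<le> 3 * N\<close>. Its power \<open>p - 4\<close> contributes
          \<open>(p - 4) / 2\<close> to the exponent of \<open>N\<close>, which together with 1
          gives \<open>p * (1 / 2 - 1 / p)\<close>.\<close>
        define B where "B = (3 * real N) powr (1 / 2) * l2_norm N a"
        have B: "norm (exp_sum k N a x) \<le> B" for x
        proof (rule power2_le_imp_le)
          have "(norm (exp_sum k N a x))\<^sup>2 \<le> (2 * real N + 1) * (l2_norm N a)\<^sup>2"
            unfolding l2_norm_squared by (rule norm_exp_sum_squared_le)
          also have "\<dots> \<le> (3 * real N) * (l2_norm N a)\<^sup>2"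
            using N by (intro mult_right_mono) auto
          also have "\<dots> = B\<^sup>2"
            by (simp add: B_def power_mult_distrib powr_half_sqrt)
          finally show "(norm (exp_sum k N a x))\<^sup>2 \<le> B\<^sup>2" .
        qed (use A in \<open>simp add: B_def\<close>)
        have "integral {0..1} (\<lambda>x. norm (exp_sum k N a x) powr p)
            \<le> B powr (p - 4) * (C4 * K * real N powr (1 + \<delta>) * l2_norm N a ^ 4)"
          using p V[OF N] by (intro integral_powr_le_sup cont B) auto
        also have "B powr (p - 4) = 3 powr ((p - 4) / 2) * real N powr ((p - 4) / 2) * l2_norm N a powr (p - 4)"
          using A N by (simp add: B_def powr_mult powr_powr)
        also have "3 powr ((p - 4) / 2) * real N powr ((p - 4) / 2) * l2_norm N a powr (p - 4)
              * (C4 * K * real N powr (1 + \<delta>) * l2_norm N a ^ 4)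
            = 3 powr ((p - 4) / 2) * (C4 * K) * (real N powr ((p - 4) / 2) * real N powr (1 + \<delta>))
              * (l2_norm N a powr (p - 4) * l2_norm N a ^ 4)"
          by (simp only: mult_ac)
        also have "real N powr ((p - 4) / 2) * real N powr (1 + \<delta>) = real N powr (p * \<alpha> k p + \<delta>)"
        proof -
          have "(p - 4) / 2 + (1 + \<delta>) = p * \<alpha> k p + \<delta>"
            using p by (simp add: \<alpha>_def field_simps)
          then show ?thesis
            by (simp only: flip: powr_add)
        qed
        also have "l2_norm N a powr (p - 4) * l2_norm N a ^ 4 = l2_norm N a powr p"
          using A by (simp flip: powr_add powr_numeral)
        finally show ?thesis .
      qed (rule zero)
    qed
  qed
qed

text \<open>For even \<open>k\<close> the reflection of \<open>x\<close> amounts to that of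
  \<open>n\<close>. For odd \<open>k\<close> the whole phase is odd in \<open>x\<close>, so
  reflection conjugates the exponentials, and conjugated coefficients restore the norm.\<close>

lemma exp_sum_reflect:
  obtains a' where "l2_norm N a' = l2_norm N a"
    and "\<And>x. norm (exp_sum k N a (- x)) = norm (exp_sum k N a' x)"
proof (cases "even k")
  case True
  show ?thesis
  proof (rule that)
    show "l2_norm N (\<lambda>n. a (- n)) = l2_norm N a"
      unfolding l2_norm_def
      by (intro arg_cong[of _ _ sqrt] sum.reindex_bij_witness[of _ uminus uminus]) auto
    have "exp_sum k N a (- x) = exp_sum k N (\<lambda>n. a (- n)) x" for x
      unfolding exp_sum_osc
      by (intro sum.reindex_bij_witness[of _ uminus uminus]) (use True in \<open>auto simp: osc_def\<close>)
    then show "norm (exp_sum k N a (- x)) = norm (exp_sum k N (\<lambda>n. a (- n)) x)" for x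
      by simp
  qed
next
  case False
  show ?thesis
  proof (rule that)
    show "l2_norm N (\<lambda>n. cnj (a n)) = l2_norm N a"
      by (simp add: l2_norm_def)
    have "exp_sum k N a (- x) = cnj (exp_sum k N (\<lambda>n. cnj (a n)) x)" for x
      unfolding exp_sum_osc cnj_sum
      by (intro sum.cong refl) (use False in \<open>simp add: osc_def cnj_ch\<close>)
    then show "norm (exp_sum k N a (- x)) = norm (exp_sum k N (\<lambda>n. cnj (a n)) x)" for x
      by simp
  qed
qed

text \<open>Continuity up to the endpoints gives integrability, so the Bochner integral is not the
  default value 0 and agrees with the gauge integral used elsewhere; the endpoints form a null
  set.\<close>

lemma Lp_norm_eq_integral:
  assumes "continuous_on {-1..1} f" "p > 0"
  shows "Lp_norm p {-1<..<1} f = integral {-1..1} (\<lambda>x. norm (f x) powr p) powr (1 / p)"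
proof -
  have "continuous_on {-1..1} (\<lambda>x. norm (f x) powr p)"
    using assms by (intro continuous_on_powr' continuous_intros) auto
  then have "set_integrable lborel {-1..1} (\<lambda>x. norm (f x) powr p)"
    by (rule borel_integrable_atLeastAtMost')
  then have "set_integrable lborel {-1<..<1} (\<lambda>x. norm (f x) powr p)"
    by (rule set_integrable_subset) auto
  then have "(LINT x:{-1<..<1}|lborel. norm (f x) powr p) = integral {-1<..<1} (\<lambda>x. norm (f x) powr p)"
    by (rule set_borel_integral_eq_integral)
  then show ?thesis
    by (simp add: Lp_norm_def integral_open_interval_real)
qed

lemma upper_bound:
  assumes "k \<ge> 2" "p \<ge> 2" "\<epsilon> > 0"
  obtains C where "\<And>N a. N \<ge> 1 \<Longrightarrow>
    Lp_norm p {-1<..<1} (exp_sum k N a) \<le> C * real N powr (\<alpha> k p + \<epsilon>) * l2_norm N a"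
proof -
  \<comment> \<open>The final root divides exponents by \<open>p\<close>, so a loss of
    \<open>p * \<epsilon>\<close> is affordable in the integral.\<close>
  have "p * \<epsilon> > 0"
    using assms by simp
  then obtain C where C: "C > 0" and half: "\<And>N a. N \<ge> 1 \<Longrightarrow> integral {0..1} (\<lambda>x. norm (exp_sum k N a x) powr p)
      \<le> C * real N powr (p * \<alpha> k p + p * \<epsilon>) * l2_norm N a powr p"
    using half_interval_bound[OF assms(1,2)] by metis
  show ?thesis
  proof (rule that)
    fix N :: nat and a :: "int \<Rightarrow> complex"
    assume N: "N \<ge> 1"
    obtain a' where a': "l2_norm N a' = l2_norm N a" "\<And>x. norm (exp_sum k N a (- x)) = norm (exp_sum k N a' x)"
      using exp_sum_reflect by metis
    let ?f = "\<lambda>x. norm (exp_sum k N a x) powr p"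
    let ?R = "real N powr (p * \<alpha> k p + p * \<epsilon>) * l2_norm N a powr p"
    have f_int: "?f integrable_on {x..y}" for x y
      using \<open>p \<ge> 2\<close> by (intro integrable_continuous_interval continuous_on_powr' continuous_intros) auto
    have "integral {-1..1} ?f = integral {-1..0} ?f + integral {0..1} ?f"
      by (intro Henstock_Kurzweil_Integration.integral_combine[symmetric] f_int) auto
    also have "integral {-1..0} ?f = integral {0..1} (\<lambda>x. ?f (- x))"
      using Henstock_Kurzweil_Integration.integral_reflect_real[of 0 "- 1" ?f] by simp
    also have "\<dots> = integral {0..1} (\<lambda>x. norm (exp_sum k N a' x) powr p)"
      by (simp only: a'(2))
    also have "\<dots> + integral {0..1} ?f \<le> C * ?R + C * ?R"
      using half[OF N, of a'] half[OF N, of a] by (intro add_mono) (simp_all add: a'(1) mult.assoc)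
    finally have le: "integral {-1..1} ?f \<le> 2 * C * ?R"
      by (simp add: mult_ac)
    have "Lp_norm p {-1<..<1} (exp_sum k N a) = integral {-1..1} ?f powr (1 / p)"
      using \<open>p \<ge> 2\<close> by (intro Lp_norm_eq_integral continuous_intros) auto
    also have "\<dots> \<le> (2 * C * ?R) powr (1 / p)"
      using le \<open>p \<ge> 2\<close> by (intro powr_mono2 integral_nonneg f_int) auto
    also have "\<dots> = (2 * C) powr (1 / p) * real N powr (\<alpha> k p + \<epsilon>) * l2_norm N a"
    proof -
      have "(p * \<alpha> k p + p * \<epsilon>) * (1 / p) = \<alpha> k p + \<epsilon>"
        using \<open>p \<ge> 2\<close> by (simp add: field_simps)
      moreover have "l2_norm N a powr (p * (1 / p)) = l2_norm N a"
        using \<open>p \<ge> 2\<close> l2_norm_nonneg[of N a] by simp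
      ultimately show ?thesis
        using C by (simp only: powr_mult powr_powr mult.assoc)
    qed
    finally show "Lp_norm p {-1<..<1} (exp_sum k N a) \<le> (2 * C) powr (1 / p) * real N powr (\<alpha> k p + \<epsilon>) * l2_norm N a" .
  qed
qed

section \<open>Extremal examples\<close>

lemma Lp_norm_ge:
  assumes "continuous_on {-1..1} f" "p > 0" "-1 \<le> l" "l \<le> u" "u \<le> 1" "B \<ge> 0"
    and lower: "\<And>x. x \<in> {l..u} \<Longrightarrow> norm (f x) \<ge> B"
  shows "Lp_norm p {-1<..<1} f \<ge> (u - l) powr (1 / p) * B"
proof -
  have cont: "continuous_on {-1..1} (\<lambda>x. norm (f x) powr p)"
    using assms by (intro continuous_on_powr' continuous_intros) auto
  have sub: "{l..u} \<subseteq> {-1..1}"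
    using assms by auto
  have "(u - l) * B powr p = integral {l..u} (\<lambda>x. B powr p)"
    using \<open>l \<le> u\<close> by simp
  also have "\<dots> \<le> integral {l..u} (\<lambda>x. norm (f x) powr p)"
    using assms continuous_on_subset[OF cont sub]
    by (intro integral_le integrable_continuous_interval powr_mono2) auto
  also have "\<dots> \<le> integral {-1..1} (\<lambda>x. norm (f x) powr p)"
    using cont continuous_on_subset[OF cont sub] sub
    by (intro integral_subset_le integrable_continuous_interval) auto
  finally have "((u - l) * B powr p) powr (1 / p) \<le> integral {-1..1} (\<lambda>x. norm (f x) powr p) powr (1 / p)"
    using assms by (intro powr_mono2) auto
  moreover have "((u - l) * B powr p) powr (1 / p) = (u - l) powr (1 / p) * B"
    using assms by (simp add: powr_mult powr_powr)
  ultimately show ?thesis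
    using assms by (simp add: Lp_norm_eq_integral)
qed

text \<open>Coefficients \<open>ch (- b n)\<close> cancel the part depending on \<open>n\<close>,
  and the part \<open>d x\<close> rotates the whole sum without changing its norm. Each remaining
  term has real part at least 1/2, so the sum has size \<open>card T / 2\<close> against a
  coefficient norm \<open>sqrt (card T)\<close>.\<close>

lemma extremizer_from_phase:
  assumes T: "T \<subseteq> {- int N..int N}" "T \<noteq> {}" and "-1 \<le> l" "l \<le> u" "u \<le> 1" "p > 0"
    and phase: "\<And>n x. n \<in> T \<Longrightarrow> x \<in> {l..u} \<Longrightarrow> \<bar>of_int n * x - (of_int n)\<^sup>2 * x ^ k - b n - d x\<bar> \<le> 1 / 6"
  shows "\<exists>a. (\<exists>n\<in>{- int N..int N}. a n \<noteq> 0) \<and>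
    Lp_norm p {-1<..<1} (exp_sum k N a) \<ge> (u - l) powr (1 / p) * (sqrt (real (card T)) / 2) * l2_norm N a"
proof (intro exI conjI)
  define a where "a n = (if n \<in> T then ch (- b n) else 0)" for n
  have fin: "finite T"
    using T by (rule_tac finite_subset) auto
  show "\<exists>n\<in>{- int N..int N}. a n \<noteq> 0"
  proof -
    obtain n where n: "n \<in> T"
      using T by blast
    then have "norm (a n) = 1"
      by (simp add: a_def)
    then show ?thesis
      using n T by force
  qed
  have "l2_norm N a = sqrt (\<Sum>n\<in>{- int N..int N}. if n \<in> T then 1 else 0)"
    unfolding l2_norm_def by (intro arg_cong[of _ _ sqrt] sum.cong) (auto simp: a_def)
  also have "(\<Sum>n\<in>{- int N..int N}. if n \<in> T then 1 else 0) = (\<Sum>n\<in>T. 1 :: real)"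
    using T by (intro sum.mono_neutral_cong_right) auto
  finally have l2: "l2_norm N a = sqrt (real (card T))"
    by simp
  have "norm (exp_sum k N a x) \<ge> real (card T) / 2" if x: "x \<in> {l..u}" for x
  proof -
    have "exp_sum k N a x = (\<Sum>n\<in>T. ch (- b n) * osc k n x)"
      unfolding exp_sum_osc using T by (intro sum.mono_neutral_cong_right) (auto simp: a_def)
    then have "exp_sum k N a x * ch (- d x) = (\<Sum>n\<in>T. ch (- b n) * osc k n x) * ch (- d x)"
      by (rule arg_cong)
    also have "\<dots> = (\<Sum>n\<in>T. ch (of_int n * x - (of_int n)\<^sup>2 * x ^ k - b n - d x))"
      unfolding sum_distrib_right osc_def ch_add[symmetric]
      by (intro sum.cong refl arg_cong[of _ _ ch]) (simp add: algebra_simps)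
    finally have "Re (exp_sum k N a x * ch (- d x)) = (\<Sum>n\<in>T. Re (ch (of_int n * x - (of_int n)\<^sup>2 * x ^ k - b n - d x)))"
      by simp
    also have "\<dots> \<ge> (\<Sum>n\<in>T. 1 / 2)"
      using phase x by (intro sum_mono Re_ch_ge_half)
    finally have "real (card T) / 2 \<le> norm (exp_sum k N a x * ch (- d x))"
      using complex_Re_le_cmod[of "exp_sum k N a x * ch (- d x)"] by simp
    then show ?thesis
      by (simp add: norm_mult)
  qed
  then have "(u - l) powr (1 / p) * (real (card T) / 2) \<le> Lp_norm p {-1<..<1} (exp_sum k N a)"
    using assms by (intro Lp_norm_ge continuous_intros) auto
  then show "Lp_norm p {-1<..<1} (exp_sum k N a) \<ge> (u - l) powr (1 / p) * (sqrt (real (card T)) / 2) * l2_norm N a"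
    by (simp add: l2 mult.assoc)
qed

lemma lower_bound_large_p:
  assumes "k \<ge> 2" "p > 0"
  shows "\<exists>c>0. \<forall>N\<ge>1. \<exists>a. (\<exists>n\<in>{- int N..int N}. a n \<noteq> 0) \<and>
    Lp_norm p {-1<..<1} (exp_sum k N a) \<ge> c * real N powr (1 / 2 - 1 / p) * l2_norm N a"
proof (intro exI[of _ "(1 / 12) powr (1 / p) / 2"] conjI allI impI)
  fix N :: nat
  assume "N \<ge> 1"
  \<comment> \<open>Chosen so that the linear part of the phase is at most 1/12. Since
    \<open>x^k \<le> x^2\<close> on \<open>[0, 1]\<close>, the other part is at most its square,
    hence also below 1/12, and the total stays within 1/6.\<close>
  define u where "u = 1 / (12 * real N)"
  have u: "0 < u" "u \<le> 1" "real N * u = 1 / 12"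
    using \<open>N \<ge> 1\<close> by (auto simp: u_def)
  have "\<exists>a. (\<exists>n\<in>{- int N..int N}. a n \<noteq> 0) \<and> Lp_norm p {-1<..<1} (exp_sum k N a)
      \<ge> (u - 0) powr (1 / p) * (sqrt (real (card {- int N..int N})) / 2) * l2_norm N a"
  proof (rule extremizer_from_phase[where T = "{- int N..int N}" and l = 0 and u = u and b = "\<lambda>_. 0" and d = "\<lambda>_. 0"])
    fix n x assume n: "n \<in> {- int N..int N}" and x: "x \<in> {0..u}"
    have nx: "\<bar>of_int n * x\<bar> \<le> 1 / 12"
    proof -
      have "\<bar>of_int n * x\<bar> \<le> real N * u"
        unfolding abs_mult using n x by (intro mult_mono) auto
      then show ?thesis
        using u by simp
    qed
    have "\<bar>(of_int n)\<^sup>2 * x ^ k\<bar> \<le> (of_int n)\<^sup>2 * x ^ 2"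
      using x u \<open>k \<ge> 2\<close> by (auto simp: abs_mult intro!: mult_left_mono power_decreasing)
    also have "\<dots> = \<bar>of_int n * x\<bar> ^ 2"
      by (simp add: power_mult_distrib)
    also have "\<dots> \<le> (1 / 12) ^ 2"
      using nx by (intro power_mono) auto
    finally have "\<bar>(of_int n)\<^sup>2 * x ^ k\<bar> \<le> 1 / 12"
      by (rule order_trans) (simp add: power2_eq_square)
    then show "\<bar>of_int n * x - (of_int n)\<^sup>2 * x ^ k - 0 - 0\<bar> \<le> 1 / 6"
      using nx by linarith
  qed (use u \<open>p > 0\<close> in auto)
  then obtain a where a: "\<exists>n\<in>{- int N..int N}. a n \<noteq> 0"
    and ge: "Lp_norm p {-1<..<1} (exp_sum k N a)
      \<ge> (u - 0) powr (1 / p) * (sqrt (real (card {- int N..int N})) / 2) * l2_norm N a"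
    by blast
  have "(1 / 12) powr (1 / p) / 2 * real N powr (1 / 2 - 1 / p)
      = u powr (1 / p) * (real N powr (1 / 2) / 2)"
    using \<open>N \<ge> 1\<close> by (simp add: u_def powr_diff powr_divide powr_mult)
  also have "\<dots> \<le> (u - 0) powr (1 / p) * (sqrt (real (card {- int N..int N})) / 2)"
    using \<open>N \<ge> 1\<close> by (auto simp: powr_half_sqrt intro!: mult_left_mono)
  finally have "(1 / 12) powr (1 / p) / 2 * real N powr (1 / 2 - 1 / p) * l2_norm N a
      \<le> Lp_norm p {-1<..<1} (exp_sum k N a)"
    by (intro order_trans[OF mult_right_mono ge] l2_norm_nonneg)
  with a show "\<exists>a. (\<exists>n\<in>{- int N..int N}. a n \<noteq> 0) \<and>
      Lp_norm p {-1<..<1} (exp_sum k N a) \<ge> (1 / 12) powr (1 / p) / 2 * real N powr (1 / 2 - 1 / p) * l2_norm N a"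
    by (intro exI[of _ a] conjI)
qed simp

section \<open>The wave packet on the fold\<close>

lemma power_diff_bounds:
  fixes x y :: real
  assumes "0 \<le> x" "x \<le> y"
  shows "y ^ k - x ^ k \<le> real k * y ^ (k - 1) * (y - x)"
    and "real k * x ^ (k - 1) * (y - x) \<le> y ^ k - x ^ k"
proof -
  define S where "S = (\<Sum>i<k. y ^ (k - Suc i) * x ^ i)"
  have "x ^ k - y ^ k = (x - y) * S"
    unfolding S_def by (rule power_diff_sumr2)
  then have eq: "y ^ k - x ^ k = S * (y - x)"
    by (simp add: algebra_simps)
  have terms: "x ^ (k - 1) \<le> y ^ (k - Suc i) * x ^ i \<and> y ^ (k - Suc i) * x ^ i \<le> y ^ (k - 1)"
    if "i < k" for i
  proof -
    have "k - 1 = (k - Suc i) + i"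
      using that by simp
    then have "x ^ (k - 1) = x ^ (k - Suc i) * x ^ i" "y ^ (k - 1) = y ^ (k - Suc i) * y ^ i"
      by (simp_all only: power_add)
    moreover have "x ^ (k - Suc i) * x ^ i \<le> y ^ (k - Suc i) * x ^ i"
      using assms by (intro mult_right_mono power_mono) auto
    moreover have "y ^ (k - Suc i) * x ^ i \<le> y ^ (k - Suc i) * y ^ i"
      using assms by (intro mult_left_mono power_mono) auto
    ultimately show ?thesis
      by simp
  qed
  have "S \<le> (\<Sum>i<k. y ^ (k - 1))" "(\<Sum>i<k. x ^ (k - 1)) \<le> S"
    unfolding S_def by (intro sum_mono; use terms in simp)+
  then have "S \<le> real k * y ^ (k - 1)" "real k * x ^ (k - 1) \<le> S"
    by simp_all
  then show "y ^ k - x ^ k \<le> real k * y ^ (k - 1) * (y - x)" "real k * x ^ (k - 1) * (y - x) \<le> y ^ k - x ^ k"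
    unfolding eq using assms by (auto intro!: mult_right_mono)
qed

text \<open>Near the point \<open>(N, x\<^sub>0)\<close> where the mixed derivative of the phase vanishes, the phase differs
  from a sum of a function of \<open>n\<close> and a function of \<open>x\<close> by a cubic error only.\<close>

lemma degenerate_phase:
  fixes n x x0 \<mu> N :: real
  assumes "k \<ge> 2" "0 < \<mu>" "real k * \<mu> \<le> 1" "0 < x0" "2 * real k * N * x0 ^ (k - 1) = 1"
    and n: "N * (1 - \<mu>) \<le> n" "n \<le> N" and x: "x0 * (1 - \<mu>) \<le> x" "x \<le> x0"
  shows "\<bar>(n * x - n\<^sup>2 * x ^ k) - (n * x0 - n\<^sup>2 * x0 ^ k) - (N * x - N\<^sup>2 * x ^ k) + (N * x0 - N\<^sup>2 * x0 ^ k)\<bar>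
    \<le> real k * (N * x0) * \<mu> ^ 3"
proof -
  define t where "t = x0 - x"
  define D where "D = x0 ^ k - x ^ k"
  have "\<mu> \<le> real k * \<mu>"
    using assms by simp
  then have \<mu>1: "\<mu> \<le> 1"
    using \<open>real k * \<mu> \<le> 1\<close> by linarith
  have x0: "0 \<le> x0 * (1 - \<mu>)"
    using \<mu>1 \<open>0 < x0\<close> by simp
  have "N > 0"
  proof (rule ccontr)
    assume "\<not> N > 0"
    then have "2 * real k * N * x0 ^ (k - 1) \<le> 0"
      using \<open>0 < x0\<close> by (intro mult_nonpos_nonneg mult_nonneg_nonpos) auto
    then show False
      unfolding assms(5) by simp
  qed
  then have n0: "n \<ge> 0"
    using n \<mu>1 by (meson diff_ge_0_iff_ge mult_nonneg_nonneg less_imp_le order_trans)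
  have t: "0 \<le> t" "t \<le> x0 * \<mu>"
    using x by (simp_all add: t_def algebra_simps)
  have D_up: "2 * N * D \<le> t"
  proof -
    have "D \<le> real k * x0 ^ (k - 1) * t"
      unfolding D_def t_def using x x0 by (intro power_diff_bounds) auto
    then have "2 * N * D \<le> 2 * N * (real k * x0 ^ (k - 1) * t)"
      using \<open>N > 0\<close> by (intro mult_left_mono) auto
    also have "\<dots> = (2 * real k * N * x0 ^ (k - 1)) * t"
      by (simp add: mult_ac)
    finally show ?thesis
      unfolding assms(5) by simp
  qed
  \<comment> \<open>By the critical equation \<open>2 * N * x^k\<close> has slope 1 at
    \<open>x0\<close>; Bernoulli's inequality bounds the loss of slope over the interval by
    \<open>(k - 1) * \<mu>\<close>. Hence \<open>2 * N * D\<close> agrees with \<open>t\<close> up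
    to that relative error.\<close>
  have D_low: "(1 - real (k - 1) * \<mu>) * t \<le> 2 * N * D"
  proof -
    have "1 + real (k - 1) * (- \<mu>) \<le> (1 + - \<mu>) ^ (k - 1)"
      using \<mu>1 by (intro Bernoulli_inequality) auto
    then have "(1 - real (k - 1) * \<mu>) * t \<le> (1 - \<mu>) ^ (k - 1) * t"
      using t by (intro mult_right_mono) auto
    also have "\<dots> = 2 * N * (real k * (x0 * (1 - \<mu>)) ^ (k - 1) * t)"
      using arg_cong[OF assms(5), of "\<lambda>z. z * ((1 - \<mu>) ^ (k - 1) * t)"] by (simp add: power_mult_distrib mult_ac)
    also have "\<dots> \<le> 2 * N * (real k * x ^ (k - 1) * t)"
      using \<open>N > 0\<close> x x0 t by (intro mult_left_mono mult_right_mono power_mono) auto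
    also have "\<dots> \<le> 2 * N * D"
      unfolding D_def t_def using x x0 \<open>N > 0\<close> by (intro mult_left_mono power_diff_bounds) auto
    finally show ?thesis .
  qed
  have D0: "D \<ge> 0"
    unfolding D_def using x x0 by (simp add: power_mono)
  \<comment> \<open>The mixed difference of the phase over the rectangle with corners
    \<open>(n, x)\<close> and \<open>(N, x0)\<close> factors as \<open>(N - n) * B\<close>. One
    factor \<open>\<mu>\<close> comes from \<open>N - n\<close>, one from the length
    \<open>t\<close>, and the third from the near cancellation in \<open>B\<close>.\<close>
  define B where "B = t - (n + N) * D"
  have "B \<ge> 0"
  proof -
    have "(n + N) * D \<le> 2 * N * D"
      using n D0 by (intro mult_right_mono) auto
    then show ?thesis
      using D_up by (simp add: B_def)
  qed
  \<comment> \<open>Moving \<open>x\<close> away from \<open>x0\<close> costs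
    \<open>(k - 1) * \<mu> * t\<close>, and replacing \<open>2 * N\<close> by \<open>n + N\<close>
    costs at most another \<open>\<mu> * t\<close>.\<close>
  moreover have "B \<le> real k * \<mu> * t"
  proof -
    have "(1 - real (k - 1) * \<mu>) * t - (N * \<mu>) * D \<le> 2 * N * D - (N * \<mu>) * D"
      using D_low by simp
    also have "\<dots> \<le> (n + N) * D"
    proof -
      have "2 * N - N * \<mu> \<le> n + N"
        using n by (simp add: algebra_simps)
      from mult_right_mono[OF this D0] show ?thesis
        by (simp add: algebra_simps)
    qed
    finally have "B \<le> real (k - 1) * \<mu> * t + \<mu> * (N * D)"
      by (simp add: B_def algebra_simps)
    also have "N * D \<le> t"
      using D_up D0 \<open>N > 0\<close> t by (simp add: mult_ac)
    finally have "B \<le> real (k - 1) * \<mu> * t + \<mu> * t"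
      using \<open>\<mu> > 0\<close> by simp
    then show ?thesis
      using \<open>k \<ge> 2\<close> by (simp add: of_nat_diff algebra_simps)
  qed
  moreover have "real k * \<mu> * t \<le> real k * \<mu> * (x0 * \<mu>)"
    using t \<open>\<mu> > 0\<close> by (intro mult_left_mono) auto
  ultimately have "0 \<le> B" "B \<le> real k * \<mu> * (x0 * \<mu>)"
    by auto
  moreover have "0 \<le> N - n" "N - n \<le> N * \<mu>"
    using n by (auto simp: algebra_simps)
  moreover have "0 \<le> N * \<mu>"
    using \<open>N > 0\<close> \<open>\<mu> > 0\<close> by simp
  ultimately have "0 \<le> (N - n) * B" "(N - n) * B \<le> (N * \<mu>) * (real k * \<mu> * (x0 * \<mu>))"
    by (simp_all only: mult_nonneg_nonneg mult_mono)
  moreover have "(n * x - n\<^sup>2 * x ^ k) - (n * x0 - n\<^sup>2 * x0 ^ k) - (N * x - N\<^sup>2 * x ^ k) + (N * x0 - N\<^sup>2 * x0 ^ k) = (N - n) * B"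
    by (simp add: B_def D_def t_def algebra_simps power2_eq_square)
  ultimately show ?thesis
    by (simp add: power3_eq_cube mult_ac)
qed

text \<open>The packet consists of the frequencies within \<open>N * \<mu>\<close> of
  \<open>N\<close> and the points within \<open>x0 * \<mu>\<close> below their fold point
  \<open>x0\<close>. Its gain is \<open>(x0 * \<mu>)^(1/p)\<close> times the square root of the
  number of frequencies.\<close>

lemma lower_bound_small_p:
  assumes "k \<ge> 2" "2 \<le> p" "p \<le> 4"
  shows "\<exists>c>0. \<forall>N\<ge>1. \<exists>a. (\<exists>n\<in>{- int N..int N}. a n \<noteq> 0) \<and>
    Lp_norm p {-1<..<1} (exp_sum k N a) \<ge> c * real N powr \<alpha> k p * l2_norm N a"
proof -
  define r where "r = 1 / real (k - 1)"
  \<comment> \<open>The phase error is of order \<open>N * x0 * \<mu>^3\<close> with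
    \<open>x0\<close> about \<open>N^(-r)\<close>; it stays bounded when \<open>\<mu>\<close> is of
    order \<open>N^(-s)\<close> with \<open>3 * s = 1 - r\<close>.\<close>
  define s where "s = (1 - r) / 3"
  \<comment> \<open>The final phase error is \<open>k * c1^3 \<le> k * c1 = 1 / 6\<close>.\<close>
  define c1 where "c1 = 1 / (6 * real k)"
  define c0 where "c0 = (1 / (2 * real k)) powr r"
  have r: "0 < r" "r \<le> 1"
    using \<open>k \<ge> 2\<close> by (auto simp: r_def)
  have c1: "0 < c1" "c1 \<le> 1" "real k * c1 \<le> 1"
    using \<open>k \<ge> 2\<close> by (auto simp: c1_def field_simps)
  have c0: "0 < c0" "c0 \<le> 1"
    using \<open>k \<ge> 2\<close> r by (auto simp: c0_def intro!: powr_le1)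
  \<comment> \<open>\<open>- r - s\<close> is the exponent of the length \<open>x0 * \<mu>\<close>,
    and \<open>1 - s\<close> that of the number of frequencies.\<close>
  have exponent: "(- r - s) * (1 / p) + (1 - s) / 2 = \<alpha> k p"
  proof -
    define K where "K = real (k - 1)"
    have K: "K \<noteq> 0" "real k = K + 1"
      using \<open>k \<ge> 2\<close> by (auto simp: K_def of_nat_diff)
    have eqs: "- r - s = - ((real k + 1) / (3 * (real k - 1)))" "(1 - s) / 2 = (2 * real k - 1) / (6 * (real k - 1))"
      unfolding r_def s_def K_def[symmetric] K(2) using K(1) by (simp_all add: field_simps)
    show ?thesis
      unfolding eqs using \<open>p \<le> 4\<close> by (simp add: \<alpha>_def mult_ac)
  qed
  have "\<exists>a. (\<exists>n\<in>{- int N..int N}. a n \<noteq> 0) \<and> Lp_norm p {-1<..<1} (exp_sum k N a)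
      \<ge> (c0 * c1) powr (1 / p) * c1 powr (1 / 2) / 2 * real N powr \<alpha> k p * l2_norm N a" if N: "N \<ge> 1" for N
  proof -
    define x0 where "x0 = (1 / (2 * real k * real N)) powr r"
    define \<mu> where "\<mu> = c1 * real N powr - s"
    have x0_eq: "x0 = c0 * real N powr - r"
    proof -
      have "x0 = (1 / (2 * real k) * (1 / real N)) powr r"
        by (simp add: x0_def)
      also have "\<dots> = c0 * (1 / real N) powr r"
        by (simp only: c0_def powr_mult)
      also have "(1 / real N) powr r = real N powr - r"
        by (simp add: powr_divide powr_minus_divide)
      finally show ?thesis .
    qed
    have x0: "0 < x0" "x0 \<le> 1" "x0 \<le> real N powr - r"
    proof -
      show "0 < x0"
        using c0 N by (simp add: x0_eq)
      have "c0 * real N powr - r \<le> 1 * real N powr - r"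
        using c0 by (intro mult_right_mono) auto
      then show le: "x0 \<le> real N powr - r"
        by (simp add: x0_eq)
      have "real N powr - r \<le> real N powr 0"
        using N r by (intro powr_mono) auto
      then show "x0 \<le> 1"
        using le N by simp
    qed
    define Q where "Q = 2 * real k * real N"
    have Q: "Q > 0"
      using N \<open>k \<ge> 2\<close> by (simp add: Q_def)
    then have "x0 ^ (k - 1) = 1 / Q"
      unfolding x0_def r_def Q_def[symmetric] by (intro powr_inverse_power \<open>k \<ge> 2\<close>) simp
    then have crit: "2 * real k * real N * x0 ^ (k - 1) = 1"
      using Q by (simp flip: Q_def)
    have "real N powr - s \<le> real N powr 0"
      using N r by (intro powr_mono) (auto simp: s_def)
    then have "\<mu> \<le> c1 * 1"
      unfolding \<mu>_def using c1 N by (intro mult_left_mono) auto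
    then have "\<mu> \<le> c1"
      by simp
    then have \<mu>: "0 < \<mu>" "\<mu> \<le> 1" "real k * \<mu> \<le> 1"
    proof -
      show "0 < \<mu>"
        using c1 N by (simp add: \<mu>_def)
      show "\<mu> \<le> 1"
        using \<open>\<mu> \<le> c1\<close> c1 by linarith
      have "real k * \<mu> \<le> real k * c1"
        using \<open>\<mu> \<le> c1\<close> by (rule mult_left_mono) simp
      then show "real k * \<mu> \<le> 1"
        using c1 by linarith
    qed
    \<comment> \<open>Rounding down and including both endpoints gives
      \<open>j + 1 \<ge> N * \<mu>\<close> frequencies, hence a nonempty set even when
      \<open>N * \<mu> < 1\<close>.\<close>
    define j where "j = nat \<lfloor>real N * \<mu>\<rfloor>"
    have "0 \<le> real N * \<mu>"
      using \<mu> by simp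
    then have "real j = of_int \<lfloor>real N * \<mu>\<rfloor>"
      unfolding j_def by (intro of_nat_nat) simp
    then have j: "real j \<le> real N * \<mu>" "real N * \<mu> \<le> real j + 1"
      by linarith+
    have "real N * \<mu> \<le> real N * 1"
      using \<mu> by (intro mult_left_mono) auto
    then have jN: "j \<le> N"
      using j(1) by simp
    define T where "T = {int N - int j..int N}"
    have card: "real (card T) = real j + 1"
      by (simp add: T_def)
    \<comment> \<open>The constant corner term \<open>N * x0 - N^2 * x0^k\<close> is booked into
      \<open>b\<close>, so that the fourfold difference takes the form of a function of
      \<open>n\<close> plus a function of \<open>x\<close>.\<close>
    have regroup: "a - (b - c) - d = a - b - d + c" for a b c d :: real
      by simp
    have "\<exists>a. (\<exists>n\<in>{- int N..int N}. a n \<noteq> 0) \<and> Lp_norm p {-1<..<1} (exp_sum k N a)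
        \<ge> (x0 - x0 * (1 - \<mu>)) powr (1 / p) * (sqrt (real (card T)) / 2) * l2_norm N a"
    proof (rule extremizer_from_phase[where k = k and N = N and p = p and
          b = "\<lambda>n. (of_int n * x0 - (of_int n)\<^sup>2 * x0 ^ k) - (real N * x0 - (real N)\<^sup>2 * x0 ^ k)"
          and d = "\<lambda>x. real N * x - (real N)\<^sup>2 * x ^ k"])
      fix n x assume n: "n \<in> T" and x: "x \<in> {x0 * (1 - \<mu>)..x0}"
      have "real_of_int n \<ge> real N - real j"
        using n by (simp add: T_def)
      then have "real N * (1 - \<mu>) \<le> of_int n"
        using j(1) by (simp add: right_diff_distrib)
      then have "\<bar>(of_int n * x - (of_int n)\<^sup>2 * x ^ k) - (of_int n * x0 - (of_int n)\<^sup>2 * x0 ^ k)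
          - (real N * x - (real N)\<^sup>2 * x ^ k) + (real N * x0 - (real N)\<^sup>2 * x0 ^ k)\<bar>
          \<le> real k * (real N * x0) * \<mu> ^ 3"
        using n x \<mu> x0 crit \<open>k \<ge> 2\<close> by (intro degenerate_phase) (auto simp: T_def)
      also have "\<dots> \<le> real k * (real N * real N powr - r) * (c1 ^ 3 * real N powr (r - 1))"
      proof -
        have "\<mu> ^ 3 = c1 ^ 3 * real N powr (r - 1)"
        proof -
          have "(real N powr - s) ^ 3 = real N powr (3 * - s)"
            using N by (simp add: powr_power)
          also have "3 * - s = r - 1"
          proof -
            have "3 * s = 1 - r"
              by (simp add: s_def)
            then show ?thesis
              by linarith
          qed
          finally show ?thesis
            by (simp only: \<mu>_def power_mult_distrib)
        qed
        then show ?thesis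
          using x0(1,3) c1(1) by (intro mult_mono mult_left_mono mult_nonneg_nonneg) simp_all
      qed
      also have "\<dots> = real k * c1 ^ 3"
      proof -
        have "real N powr (1 + - r + (r - 1)) = real N powr 1 * real N powr - r * real N powr (r - 1)"
          by (simp only: powr_add)
        then have one: "real N * real N powr - r * real N powr (r - 1) = 1"
          using N by simp
        have "real k * (real N * real N powr - r) * (c1 ^ 3 * real N powr (r - 1))
            = real k * c1 ^ 3 * (real N * real N powr - r * real N powr (r - 1))"
          by (simp only: mult_ac)
        then show ?thesis
          by (simp only: one mult_1_right)
      qed
      also have "\<dots> \<le> real k * c1 ^ 1"
        using c1 by (intro mult_left_mono power_decreasing) auto
      also have "\<dots> = 1 / 6"
        using \<open>k \<ge> 2\<close> by (simp add: c1_def)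
      finally show "\<bar>of_int n * x - (of_int n)\<^sup>2 * x ^ k
          - ((of_int n * x0 - (of_int n)\<^sup>2 * x0 ^ k) - (real N * x0 - (real N)\<^sup>2 * x0 ^ k))
          - (real N * x - (real N)\<^sup>2 * x ^ k)\<bar> \<le> 1 / 6"
        unfolding regroup .
    next
      have "0 \<le> x0 * (1 - \<mu>)"
        using x0(1) \<mu>(2) by (intro mult_nonneg_nonneg) linarith+
      then show "-1 \<le> x0 * (1 - \<mu>)"
        by linarith
      have "x0 * (1 - \<mu>) \<le> x0 * 1"
        using x0(1) \<mu>(1) by (intro mult_left_mono) linarith+
      then show "x0 * (1 - \<mu>) \<le> x0"
        by (simp only: mult_1_right)
      show "T \<subseteq> {- int N..int N}" "T \<noteq> {}"
        using jN by (auto simp: T_def)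
    qed (use x0(2) assms(2) in linarith)+
    then obtain a where a: "\<exists>n\<in>{- int N..int N}. a n \<noteq> 0"
      and ge: "Lp_norm p {-1<..<1} (exp_sum k N a)
        \<ge> (x0 - x0 * (1 - \<mu>)) powr (1 / p) * (sqrt (real (card T)) / 2) * l2_norm N a"
      by (elim exE conjE)
    have "(c0 * c1) powr (1 / p) * c1 powr (1 / 2) / 2 * real N powr \<alpha> k p
        = (x0 * \<mu>) powr (1 / p) * ((real N * \<mu>) powr (1 / 2) / 2)"
    proof -
      have "x0 * \<mu> = (c0 * c1) * real N powr (- r - s)"
        by (simp add: x0_eq \<mu>_def flip: powr_add)
      then have 1: "(x0 * \<mu>) powr (1 / p) = (c0 * c1) powr (1 / p) * real N powr ((- r - s) * (1 / p))"
        using c0 c1 by (simp only: powr_mult powr_powr)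
      have "real N * \<mu> = c1 * real N powr (1 - s)"
      proof -
        have "real N * real N powr - s = real N powr 1 * real N powr - s"
          using N by simp
        also have "\<dots> = real N powr (1 - s)"
          using powr_add[of "real N" 1 "- s"] by simp
        finally show ?thesis
          by (simp add: \<mu>_def)
      qed
      then have 2: "(real N * \<mu>) powr (1 / 2) = c1 powr (1 / 2) * real N powr ((1 - s) / 2)"
        using c1 by (simp add: powr_mult powr_powr)
      have rearrange: "a * b / 2 * (c * d) = a * c * (b * d / 2)" for a b c d :: real
        by simp
      show ?thesis
        unfolding 1 2 exponent[symmetric] powr_add by (rule rearrange)
    qed
    also have "\<dots> \<le> (x0 * \<mu>) powr (1 / p) * (sqrt (real (card T)) / 2)"
      using j(2) \<mu> by (intro mult_left_mono divide_right_mono) (auto simp: card powr_half_sqrt)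
    also have "x0 * \<mu> = x0 - x0 * (1 - \<mu>)"
      by (simp add: right_diff_distrib)
    finally have "(c0 * c1) powr (1 / p) * c1 powr (1 / 2) / 2 * real N powr \<alpha> k p * l2_norm N a
        \<le> Lp_norm p {-1<..<1} (exp_sum k N a)"
      by (intro order_trans[OF mult_right_mono ge] l2_norm_nonneg)
    with a show ?thesis
      by (intro exI[of _ a] conjI)
  qed
  moreover have "(c0 * c1) powr (1 / p) * c1 powr (1 / 2) / 2 > 0"
    using c0 c1 by simp
  ultimately show ?thesis
    by (intro exI[of _ "(c0 * c1) powr (1 / p) * c1 powr (1 / 2) / 2"] conjI allI impI)
qed

theorem theorem4p8:
  fixes k :: nat and p :: real
  assumes "k \<ge> 2" and "p \<ge> 2"
  shows "(\<forall>\<epsilon>::real. \<epsilon> > 0 \<longrightarrow>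
            (\<exists>C::real. \<forall>N::nat. N \<ge> 1 \<longrightarrow> (\<forall>a::int \<Rightarrow> complex.
               Lp_norm p {-1<..<1} (exp_sum k N a) \<le> C * real N powr (\<alpha> k p + \<epsilon>) * l2_norm N a)))
       \<and> (\<exists>c::real. c > 0 \<and> (\<forall>N::nat. N \<ge> 1 \<longrightarrow>
            (\<exists>a::int \<Rightarrow> complex. (\<exists>n\<in>{- int N..int N}. a n \<noteq> 0) \<and>
               Lp_norm p {-1<..<1} (exp_sum k N a) \<ge> c * real N powr \<alpha> k p * l2_norm N a)))"
proof (intro conjI allI impI)
  fix \<epsilon> :: real
  assume "\<epsilon> > 0"
  then show "\<exists>C::real. \<forall>N::nat. N \<ge> 1 \<longrightarrow> (\<forall>a::int \<Rightarrow> complex.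
      Lp_norm p {-1<..<1} (exp_sum k N a) \<le> C * real N powr (\<alpha> k p + \<epsilon>) * l2_norm N a)"
    using upper_bound[OF assms] by metis
next
  show "\<exists>c::real. c > 0 \<and> (\<forall>N::nat. N \<ge> 1 \<longrightarrow>
      (\<exists>a::int \<Rightarrow> complex. (\<exists>n\<in>{- int N..int N}. a n \<noteq> 0) \<and>
         Lp_norm p {-1<..<1} (exp_sum k N a) \<ge> c * real N powr \<alpha> k p * l2_norm N a))"
  proof (cases "p \<le> 4")
    case True
    then show ?thesis
      by (rule lower_bound_small_p[OF assms])
  next
    case False
    then have "\<alpha> k p = 1 / 2 - 1 / p"
      by (simp add: \<alpha>_def)
    moreover have "p > 0"
      using assms(2) by simp
    ultimately show ?thesis
      using lower_bound_large_p[OF assms(1), of p] by (simp only:)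
  qed
qed

end
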